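(* Let $n\ge 1$ and let $P$ be a countable dense subset of the sphere $S^{n}$. For every $p\in P$, let $\pi_{p}:D^{n}\to S^{n}$ be a map from the closed $n$-ball that collapses the boundary of $D^n$ to the point $p$. Then the limit space $\varprojlim\{D^{n},\pi_{p}\}_{p\in P}$ is homeomorphic to the $(n-1)$-dimensional Sierpiński carpet $M^{n}_{n-1}$.
   Context: Collapsing map: $\pi_p:D^n\to S^n$ is a continuous surjection with $\pi_p^{-1}(p)=\partial D^n$ that is injective on the interior of $D^n$ (so it induces a homeomorphism $D^n/\partial D^n\cong S^n$ sending the class of $\partial D^n$ to $p$). Limit space: $\varprojlim\{D^n,\pi_p\}_{p\in P}$ is the limit of the diagram consisting of one copy of $D^n$ for each $p\in P$, each mapping to the common space $S^n$ by $\pi_p$; that is, the subspace $\{(x_p)_{p\in P}\in\prod_{p\in P}D^n:\ \pi_p(x_p)=\pi_q(x_q)\ \text{for all } p,q\in P\}$ of the product. Tame balls: an open or closed subset $D$ of $S^n$ is a tame ball if $\overline{D}$ and $S^n-\mathrm{int}(D)$ are both homeomorphic to closed $n$-balls. Sierpiński carpet: $M^n_{n-1}$ is the space $S^n-\bigcup_{i\in\mathbb N}C_i$, where $\{C_i\}_{i\in\mathbb N}$ is an infinite family of open tame balls in $S^n$ with pairwise disjoint closures such that (1) $\bigcup_{i\in\mathbb N}\overline{C_i}$ is dense in $S^n$, and (2) for every $\epsilon>0$ the set $\{i:\operatorname{diam}\overline{C_i}>\epsilon\}$ is finite. It is known (Whyburn, Cannon) that, up to homeomorphism, this space does not depend on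 the choice of the family $\{C_i\}$; for $n=1$ it is a Cantor set. *)

theory Defs
  imports "HOL-Analysis.Analysis"
begin

text \<open>
  Throughout, \<^typ>\<open>'a\<close> is a Euclidean space of dimension \<open>n = DIM('a) \<ge> 1\<close>;
  \<open>D\<^sup>n\<close> is \<^term>\<open>cball (0::'a::euclidean_space) 1\<close> and \<open>S\<^sup>n\<close> is
  \<^term>\<open>sphere (0::'a::euclidean_space \<times> real) 1\<close>, the unit sphere of the
  Euclidean space \<^typ>\<open>'a \<times> real\<close> of dimension \<open>n + 1\<close>.
\<close>

definition collapsing_map ::
  "'a::euclidean_space \<times> real \<Rightarrow> ('a \<Rightarrow> 'a \<times> real) \<Rightarrow> bool" where
  "collapsing_map p f \<longleftrightarrow>
     continuous_on (cball 0 1) f \<and>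
     f ` cball 0 1 = sphere 0 1 \<and>
     {x \<in> cball 0 1. f x = p} = sphere 0 1 \<and>
     inj_on f (ball 0 1)"

definition limit_space ::
  "('a::euclidean_space \<times> real) set \<Rightarrow> ('a \<times> real \<Rightarrow> 'a \<Rightarrow> 'a \<times> real)
     \<Rightarrow> ('a \<times> real \<Rightarrow> 'a) topology" where
  "limit_space P \<pi> =
     subtopology (product_topology (\<lambda>p. top_of_set (cball 0 1)) P)
       {x. \<forall>p\<in>P. \<forall>q\<in>P. \<pi> p (x p) = \<pi> q (x q)}"

text \<open>
  The interior is taken relative to \<open>S\<^sup>n\<close> (the ambient one is empty). The ambient
  \<^const>\<open>closure\<close> is also the closure in \<open>S\<^sup>n\<close>, as \<open>S\<^sup>n\<close> is closed.
\<close>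

definition tame_ball :: "('a::euclidean_space \<times> real) set \<Rightarrow> bool" where
  "tame_ball D \<longleftrightarrow>
     (openin (top_of_set (sphere 0 1)) D \<or> closedin (top_of_set (sphere 0 1)) D) \<and>
     closure D homeomorphic cball (0::'a) 1 \<and>
     (sphere 0 1 - (top_of_set (sphere 0 1)) interior_of D) homeomorphic cball (0::'a) 1"

definition carpet_family :: "(nat \<Rightarrow> ('a::euclidean_space \<times> real) set) \<Rightarrow> bool" where
  "carpet_family C \<longleftrightarrow>
     (\<forall>i. openin (top_of_set (sphere 0 1)) (C i) \<and> tame_ball (C i)) \<and>
     (\<forall>i j. i \<noteq> j \<longrightarrow> closure (C i) \<inter> closure (C j) = {}) \<and>
     closure (\<Union>i. closure (C i)) = sphere 0 1 \<and>
     (\<forall>\<epsilon>>0. finite {i. diameter (closure (C i)) > \<epsilon>})"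

text \<open>
  The carpet is a space defined only up to homeomorphism: \<open>M\<close> is a carpet if it arises
  from some admissible family, and being homeomorphic to the carpet means being
  homeomorphic to some such \<open>M\<close>. By the theorem of Whyburn and Cannon any two carpets
  of the same dimension are homeomorphic; the lemma below records that, given this
  theorem, the choice of the family is immaterial.
\<close>

definition sierpinski_carpet :: "('a::euclidean_space \<times> real) set \<Rightarrow> bool" where
  "sierpinski_carpet M \<longleftrightarrow> (\<exists>C. carpet_family C \<and> M = sphere 0 1 - (\<Union>i. C i))"

lemma homeomorphic_every_carpet:
  fixes X :: "'x topology" and N :: "('a::euclidean_space \<times> real) set"
  assumes Whyburn_Cannon:
      "\<And>(M :: ('a \<times> real) set) (N :: ('a \<times> real) set).
         sierpinski_carpet M \<Longrightarrow> sierpinski_carpet N \<Longrightarrow> M homeomorphic N"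
    and "\<exists>M :: ('a \<times> real) set. sierpinski_carpet M \<and> X homeomorphic_space top_of_set M"
    and "sierpinski_carpet N"
  shows "X homeomorphic_space top_of_set N"
proof -
  obtain M :: "('a \<times> real) set"
    where "sierpinski_carpet M" and XM: "X homeomorphic_space top_of_set M"
    using assms(2) by blast
  then have "M homeomorphic N"
    using Whyburn_Cannon assms(3) by blast
  then have "top_of_set M homeomorphic_space top_of_set N"
    unfolding homeomorphic_def homeomorphism_def homeomorphic_space_def homeomorphic_maps_def
    by fastforce
  with XM show ?thesis
    by (rule homeomorphic_space_trans)
qed

end

theory Submission
  imports Defs
begin

text \<open>
  Enumerate \<open>P\<close> as \<open>p\<^sub>0, p\<^sub>1, \<dots>\<close> and replace the points by small balls one after the
  other. In the coordinates \<open>\<pi>\<^sub>k\<close> on a thin collar of \<open>\<partial>D\<^sup>n\<close>, the radial map that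
  pushes the outer half of the collar into \<open>\<partial>D\<^sup>n\<close> induces a self-map \<open>s\<^sub>k\<close> of the
  sphere, supported near \<open>p\<^sub>k\<close>, that collapses a closed ball onto \<open>p\<^sub>k\<close>. The compositions
  \<open>g\<^sub>k = s\<^sub>k\<^sub>-\<^sub>1 \<circ> \<dots> \<circ> s\<^sub>0\<close> are rewritten as \<open>c\<^sub>0 \<circ> \<dots> \<circ> c\<^sub>k\<^sub>-\<^sub>1\<close>, where \<open>c\<^sub>k\<close> is
  conjugate to \<open>s\<^sub>k\<close> and moves points as little as desired. Hence the infinite compositions
  \<open>c\<^sub>k \<circ> c\<^sub>k\<^sub>+\<^sub>1 \<circ> \<dots>\<close> converge uniformly, and they tend to the identity as \<open>k\<close> grows.
  The total composition \<open>g\<close> collapses disjoint tame balls \<open>B\<^sub>k\<close> to the points \<open>p\<^sub>k\<close> and is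
  injective otherwise. As each \<open>s\<^sub>k\<close> is built from \<open>\<pi>\<^sub>k\<close>, the map \<open>g\<close> lifts
  through every \<open>\<pi>\<^sub>k\<close> on the complement of the interiors of the balls, bijectively on
  \<open>\<partial>B\<^sub>k\<close>; the lifts are the components of the homeomorphism onto the limit space.
\<close>

subsection \<open>Quotients of compact spaces and radial maps\<close>

text \<open>A continuous map from a compact to a Hausdorff space is closed on its image: the
  preimage of a closed set under the induced map is the \<open>f\<close>-image of a compact set.
  This is how maps descend from the ball to the sphere.\<close>

lemma compact_quotient_factor:
  fixes f :: "'x::topological_space \<Rightarrow> 'y::t2_space" and g :: "'x \<Rightarrow> 'z::topological_space"
  assumes K: "compact K" and f: "continuous_on K f" and g: "continuous_on K g"
    and fg: "\<And>x y. x \<in> K \<Longrightarrow> y \<in> K \<Longrightarrow> f x = f y \<Longrightarrow> g x = g y"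
  obtains k where "continuous_on (f ` K) k" "\<And>x. x \<in> K \<Longrightarrow> k (f x) = g x"
proof
  define k where "k = g \<circ> inv_into K f"
  show kf: "k (f x) = g x" if "x \<in> K" for x
    using fg[of "inv_into K f (f x)" x] that
    by (simp add: k_def f_inv_into_f inv_into_into)
  have "closed (f ` K)"
    by (simp add: K f compact_continuous_image compact_imp_closed)
  moreover have "closed (k -` B \<inter> f ` K)" if "closed B" for B
  proof -
    have "compact (K \<inter> g -` B)"
      using continuous_closedin_preimage[OF g that] K closedin_compact by blast
    then have "compact (f ` (K \<inter> g -` B))"
      by (meson compact_continuous_image continuous_on_subset f inf_le1)
    moreover have "k -` B \<inter> f ` K = f ` (K \<inter> g -` B)"
      using kf by auto
    ultimately show ?thesis
      by (simp add: compact_imp_closed)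
  qed
  ultimately show "continuous_on (f ` K) k"
    using continuous_on_closed_vimage by blast
qed

text \<open>Two quotients of one compact set with the same fibres are identified. Used to recognise
  the closure of a hole as a ball.\<close>

lemma homeomorphic_compact_quotients:
  fixes f :: "'x::topological_space \<Rightarrow> 'y::t2_space" and g :: "'x \<Rightarrow> 'z::t2_space"
  assumes K: "compact K" and f: "continuous_on K f" and g: "continuous_on K g"
    and fg: "\<And>x y. x \<in> K \<Longrightarrow> y \<in> K \<Longrightarrow> f x = f y \<longleftrightarrow> g x = g y"
  shows "f ` K homeomorphic g ` K"
proof -
  obtain k where k: "continuous_on (f ` K) k" "\<And>x. x \<in> K \<Longrightarrow> k (f x) = g x"
    using compact_quotient_factor[OF K f g] fg by metis
  have "compact (f ` K)"
    by (simp add: K f compact_continuous_image)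
  moreover have "k ` f ` K = g ` K"
    using k(2) by (force simp: image_iff)
  moreover have "inj_on k (f ` K)"
    using k(2) fg by (auto simp: inj_on_def)
  ultimately show ?thesis
    using homeomorphic_compact k(1) by blast
qed

text \<open>
  For \<open>\<kappa> = 0\<close> the interval \<open>[(1 + r) / 2, 1]\<close> is collapsed to \<open>1\<close>; a small \<open>\<kappa> > 0\<close> gives a
  homeomorphism of \<open>[0, 1]\<close> that differs from the collapse only where the latter exceeds \<open>1 - \<kappa>\<close>.
\<close>
definition stretch :: "real \<Rightarrow> real \<Rightarrow> real \<Rightarrow> real" where
  "stretch \<kappa> r t = min (max t (2 * t - r)) (1 - \<kappa> * (1 - t))"

text \<open>At \<open>y = 0\<close> the division by zero is harmless, since the factor multiplies
  the zero vector.\<close>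

definition radial_stretch :: "real \<Rightarrow> real \<Rightarrow> 'a::real_normed_vector \<Rightarrow> 'a" where
  "radial_stretch \<kappa> r y = (stretch \<kappa> r (norm y) / norm y) *\<^sub>R y"

context
  fixes \<kappa> r :: real
  assumes \<kappa>: "0 \<le> \<kappa>" "\<kappa> < 1" and r: "0 < r" "r < 1"
begin

lemma stretch_inner: "t \<le> r \<Longrightarrow> stretch \<kappa> r t = t"
proof -
  assume "t \<le> r"
  then have "0 \<le> (1 - \<kappa>) * (1 - t)" using \<kappa> r by simp
  then have "t \<le> 1 - \<kappa> * (1 - t)" by (simp add: algebra_simps)
  with \<open>t \<le> r\<close> show ?thesis by (simp add: stretch_def)
qed

lemma stretch_ge: "t \<le> 1 \<Longrightarrow> t \<le> stretch \<kappa> r t"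
proof -
  assume "t \<le> 1"
  then have "0 \<le> (1 - \<kappa>) * (1 - t)" using \<kappa> r by simp
  then have "t \<le> 1 - \<kappa> * (1 - t)" by (simp add: algebra_simps)
  then show ?thesis by (simp add: stretch_def)
qed

lemma stretch_le_1: "t \<le> 1 \<Longrightarrow> stretch \<kappa> r t \<le> 1"
  using \<kappa> mult_nonneg_nonneg[of \<kappa> "1 - t"] by (simp add: stretch_def min_le_iff_disj)

lemma stretch_less_1: "0 < \<kappa> \<Longrightarrow> t < 1 \<Longrightarrow> stretch \<kappa> r t < 1"
  using mult_pos_pos[of \<kappa> "1 - t"] by (simp add: stretch_def min_less_iff_disj)

lemma stretch_strict_mono:
  assumes "0 < \<kappa>" "s < t"
  shows "stretch \<kappa> r s < stretch \<kappa> r t"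
proof -
  have "1 - \<kappa> * (1 - s) < 1 - \<kappa> * (1 - t)"
    using assms by simp
  then show ?thesis
    using assms(2) by (simp add: stretch_def min_def max_def)
qed

text \<open>The two functions differ only through the cap \<open>1 - \<kappa> * (1 - t)\<close>,
  which for \<open>t > 0\<close> and \<open>\<kappa> > 0\<close> lies strictly above
  \<open>1 - \<kappa>\<close> and so is inactive at values up to \<open>1 - \<kappa>\<close>. At
  \<open>t = 0\<close> both are 0.\<close>

lemma stretch_agree:
  assumes t: "0 \<le> t" "t \<le> 1"
    and le: "stretch \<kappa> r t \<le> 1 - \<kappa> \<or> stretch 0 r t \<le> 1 - \<kappa>"
  shows "stretch \<kappa> r t = stretch 0 r t"
proof (cases "t = 0 \<or> \<kappa> = 0")
  case True
  then show ?thesis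
    using r \<kappa> by (auto simp: stretch_inner[of 0]) (simp add: stretch_def)
next
  case False
  then have "0 < t" "1 - \<kappa> < 1 - \<kappa> * (1 - t)" "1 - \<kappa> * (1 - t) \<le> 1"
    using t \<kappa> by (simp_all add: algebra_simps)
  then show ?thesis
    using le \<kappa> by (simp add: stretch_def min_def max_def split: if_splits)
qed

lemma norm_radial_stretch:
  assumes "norm y \<le> 1"
  shows "norm (radial_stretch \<kappa> r y) = stretch \<kappa> r (norm y)"
proof -
  have "0 \<le> stretch \<kappa> r (norm y)"
    using order_trans[OF norm_ge_zero stretch_ge[OF assms]] .
  moreover have "stretch \<kappa> r 0 = 0"
    using stretch_inner[of 0] r by simp
  ultimately show ?thesis
    by (cases "y = 0") (simp_all add: radial_stretch_def)
qed

lemma radial_stretch_inner: "norm y \<le> r \<Longrightarrow> radial_stretch \<kappa> r y = y"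
  by (simp add: radial_stretch_def stretch_inner)

lemma continuous_on_radial_stretch:
  "continuous_on (cball 0 1) (radial_stretch \<kappa> r :: 'b::real_normed_vector \<Rightarrow> 'b)"
proof -
  \<comment> \<open>Gluing over two closed pieces keeps the division by \<open>norm y\<close> away
    from the origin, near which the map is the identity.\<close>
  let ?A = "cball 0 r :: 'b set" and ?B = "cball 0 1 - ball 0 r :: 'b set"
  have "continuous_on ?A (radial_stretch \<kappa> r :: 'b \<Rightarrow> 'b)"
    by (rule continuous_on_eq[of _ id]) (auto simp: radial_stretch_inner)
  moreover have "continuous_on ?B (radial_stretch \<kappa> r :: 'b \<Rightarrow> 'b)"
    unfolding radial_stretch_def stretch_def
    using r by (intro continuous_intros) auto
  ultimately have "continuous_on (?A \<union> ?B) (radial_stretch \<kappa> r :: 'b \<Rightarrow> 'b)"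
    by (intro continuous_on_closed_Un) (auto intro: closed_Diff)
  moreover have "cball 0 1 = ?A \<union> ?B"
    using r by auto
  ultimately show ?thesis by simp
qed

lemma inj_on_radial_stretch:
  assumes inj: "inj_on (stretch \<kappa> r) (norm ` T)" and T: "T \<subseteq> cball 0 1"
  shows "inj_on (radial_stretch \<kappa> r) T"
proof (rule inj_onI)
  fix y z assume yz: "y \<in> T" "z \<in> T" and eq: "radial_stretch \<kappa> r y = radial_stretch \<kappa> r z"
  have le: "norm y \<le> 1" "norm z \<le> 1"
    using T yz by auto
  then have "stretch \<kappa> r (norm y) = stretch \<kappa> r (norm z)"
    using eq norm_radial_stretch by metis
  then have n: "norm y = norm z"
    using inj yz by (auto simp: inj_on_def)
  show "y = z"
  proof (cases "y = 0")
    case True then show ?thesis using n by simp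
  next
    case False
    then have "stretch \<kappa> r (norm y) / norm y \<noteq> 0"
      using stretch_ge[OF le(1)] by auto
    then show ?thesis
      using eq n unfolding radial_stretch_def by (metis scaleR_left_imp_eq)
  qed
qed

lemma radial_stretch_image:
  assumes "0 < \<kappa>"
  shows "radial_stretch \<kappa> r ` cball 0 1 = (cball 0 1 :: 'b::real_normed_vector set)"
proof
  show "radial_stretch \<kappa> r ` cball 0 1 \<subseteq> (cball 0 1 :: 'b set)"
    using norm_radial_stretch stretch_le_1 by fastforce
  show "cball 0 1 \<subseteq> radial_stretch \<kappa> r ` (cball 0 1 :: 'b set)"
  proof
    fix y :: 'b assume y: "y \<in> cball 0 1"
    have "stretch \<kappa> r 0 \<le> norm y" "norm y \<le> stretch \<kappa> r 1"
      using y r by (simp_all add: stretch_inner) (simp add: stretch_def)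
    moreover have "continuous_on {0..1} (stretch \<kappa> r)"
      unfolding stretch_def by (intro continuous_intros)
    ultimately obtain t where t: "0 \<le> t" "t \<le> 1" "stretch \<kappa> r t = norm y"
      using IVT'[of "stretch \<kappa> r" 0 "norm y" 1] by auto
    show "y \<in> radial_stretch \<kappa> r ` cball 0 1"
    proof (cases "y = 0")
      case True
      then show ?thesis using r by (auto intro!: image_eqI[of _ _ 0] simp: radial_stretch_def)
    next
      case False
      then have "t > 0"
        using t r stretch_inner[of 0] by (cases "t = 0") auto
      have "norm ((t / norm y) *\<^sub>R y) = t"
        using False t by simp
      then have "radial_stretch \<kappa> r ((t / norm y) *\<^sub>R y) = y"
        using False t \<open>t > 0\<close> by (simp add: radial_stretch_def)
      moreover have "(t / norm y) *\<^sub>R y \<in> cball 0 1"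
        using False t by simp
      ultimately show ?thesis by (metis image_eqI)
    qed
  qed
qed

end

lemma stretch_0_eq_1_iff:
  assumes "0 < r" "r < 1"
  shows "stretch 0 r t = 1 \<longleftrightarrow> (1 + r) / 2 \<le> t \<or> 1 \<le> t"
  using assms by (auto simp: stretch_def min_def max_def field_simps)

lemma compact_subset_smaller_ball:
  fixes K :: "'a::real_normed_vector set"
  assumes "compact K" "K \<subseteq> ball 0 1"
  obtains r where "0 < r" "r < 1" "\<And>y. y \<in> K \<Longrightarrow> norm y < r"
proof (cases "K = {}")
  case True
  then show ?thesis using that[of "1/2"] by simp
next
  case False
  then obtain x where x: "x \<in> K" "\<forall>y\<in>K. norm y \<le> norm x"
    using continuous_attains_sup[of K norm] assms(1) continuous_on_norm_id by blast
  then have "norm x < 1"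
    using assms(2) by auto
  moreover from this have "0 < (1 + norm x) / 2"
    by (simp add: add_pos_nonneg)
  moreover have "norm y < (1 + norm x) / 2" if "y \<in> K" for y
    using x \<open>norm x < 1\<close> that by force
  ultimately show ?thesis
    using that[of "(1 + norm x) / 2"] by simp
qed

text \<open>Reversing the radius turns an annulus with its outer sphere collapsed into a ball:
  \<open>norm y = r\<close> goes to the boundary and \<open>norm y = 1\<close> to the
  centre.\<close>

lemma collapse_outer_sphere:
  fixes r :: real and g :: "'a::euclidean_space \<Rightarrow> 'a"
  assumes r: "0 < r" "r < 1"
  defines "g \<equiv> \<lambda>y. ((1 - norm y) / ((1 - r) * norm y)) *\<^sub>R y"
  shows "continuous_on (cball 0 1 - ball 0 r) g"
    and "g ` (cball 0 1 - ball 0 r) = cball 0 1"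
    and "\<And>x y. x \<in> cball 0 1 - ball 0 r \<Longrightarrow> y \<in> cball 0 1 - ball 0 r \<Longrightarrow>
           g x = g y \<longleftrightarrow> x = y \<or> norm x = 1 \<and> norm y = 1"
proof -
  have nz: "(1 - r) * norm y \<noteq> 0" if "y \<in> cball 0 1 - ball 0 r" for y :: 'a
    using that r by auto
  show "continuous_on (cball 0 1 - ball 0 r) g"
    unfolding g_def using nz by (intro continuous_intros) auto
  have ng: "norm (g y) = (1 - norm y) / (1 - r)" if "y \<in> cball 0 1 - ball 0 r" for y :: 'a
    using that r nz[OF that] by (simp add: g_def)
  show "g x = g y \<longleftrightarrow> x = y \<or> norm x = 1 \<and> norm y = 1"
    if x: "x \<in> cball 0 1 - ball 0 r" and y: "y \<in> cball 0 1 - ball 0 r" for x y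
  proof
    assume eq: "g x = g y"
    then have n: "norm x = norm y"
      using ng[OF x] ng[OF y] r by simp
    show "x = y \<or> norm x = 1 \<and> norm y = 1"
    proof (cases "norm x = 1")
      case False
      then have "(1 - norm x) / ((1 - r) * norm x) \<noteq> 0"
        using nz[OF x] by simp
      then show ?thesis
        using eq n unfolding g_def by (metis scaleR_left_imp_eq)
    qed (use n in simp)
  qed (auto simp: g_def)
  show "g ` (cball 0 1 - ball 0 r) = cball 0 1"
  proof
    show "g ` (cball 0 1 - ball 0 r) \<subseteq> cball 0 1"
      using ng r by (auto simp: divide_le_eq)
    show "cball 0 1 \<subseteq> g ` (cball 0 1 - ball 0 r)"
    proof
      fix z :: 'a assume z: "z \<in> cball 0 1"
      show "z \<in> g ` (cball 0 1 - ball 0 r)"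
      proof (cases "z = 0")
        case True
        obtain b :: 'a where "b \<in> Basis"
          using nonempty_Basis by blast
        then show ?thesis
          using True r by (auto intro!: image_eqI[of _ _ b] simp: g_def)
      next
        case False
        \<comment> \<open>The radius solving \<open>(1 - t) / (1 - r) = norm z\<close>.\<close>
        define t where "t = 1 - (1 - r) * norm z"
        have t: "r \<le> t" "t \<le> 1"
        proof -
          have "(1 - r) * norm z \<le> 1 - r"
            using z r by (intro mult_left_le) auto
          then show "r \<le> t" "t \<le> 1"
            unfolding t_def using z r by (linarith, simp)
        qed
        define y where "y = (t / norm z) *\<^sub>R z"
        have "norm y = t"
          using False t r by (simp add: y_def)
        moreover have "g y = z"
          unfolding g_def \<open>norm y = t\<close> using False t r
          by (simp add: y_def) (simp add: t_def)
        ultimately show ?thesis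
          using t r by (intro image_eqI[of _ _ y]) auto
      qed
    qed
  qed
qed

subsection \<open>Collapsing maps\<close>

context
  fixes p :: "'a::euclidean_space \<times> real" and \<pi> :: "'a \<Rightarrow> 'a \<times> real"
  assumes coll: "collapsing_map p \<pi>"
begin

lemma collapsing_map_continuous: "continuous_on (cball 0 1) \<pi>"
  and collapsing_map_image: "\<pi> ` cball 0 1 = sphere 0 1"
  and collapsing_map_in_sphere: "\<And>x. norm x \<le> 1 \<Longrightarrow> \<pi> x \<in> sphere 0 1"
  and collapsing_map_eq_point_iff: "\<And>x. norm x \<le> 1 \<Longrightarrow> \<pi> x = p \<longleftrightarrow> norm x = 1"
  using coll by (auto simp: collapsing_map_def)

lemma collapsing_map_eq_iff:
  assumes "norm x \<le> 1" "norm y \<le> 1"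
  shows "\<pi> x = \<pi> y \<longleftrightarrow> x = y \<or> norm x = 1 \<and> norm y = 1"
proof (cases "norm x = 1 \<or> norm y = 1")
  case True
  then show ?thesis
    using collapsing_map_eq_point_iff assms by metis
next
  case False
  moreover have "inj_on \<pi> (ball 0 1)"
    using coll by (simp add: collapsing_map_def)
  ultimately show ?thesis
    using assms by (auto simp: inj_on_def)
qed

text \<open>The stretch maps the boundary sphere into itself, so
  \<open>\<pi> \<circ> radial_stretch \<kappa> r\<close> is constant on the fibres of
  \<open>\<pi>\<close> and descends to the sphere.\<close>

lemma collapsing_map_stretch:
  assumes \<kappa>: "0 \<le> \<kappa>" "\<kappa> < 1" and r: "0 < r" "r < 1"
  obtains s where "continuous_on (sphere 0 1) s" "s ` sphere 0 1 \<subseteq> sphere 0 1"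
    "\<And>y. norm y \<le> 1 \<Longrightarrow> s (\<pi> y) = \<pi> (radial_stretch \<kappa> r y)"
proof -
  note ns = norm_radial_stretch[OF \<kappa> r] stretch_le_1[OF \<kappa> r]
  have "continuous_on (cball 0 1) (\<pi> \<circ> radial_stretch \<kappa> r)"
    by (intro continuous_on_compose continuous_on_radial_stretch[OF \<kappa> r]
          continuous_on_subset[OF collapsing_map_continuous]) (auto simp: ns)
  moreover have "(\<pi> \<circ> radial_stretch \<kappa> r) x = (\<pi> \<circ> radial_stretch \<kappa> r) y"
    if "x \<in> cball 0 1" "y \<in> cball 0 1" "\<pi> x = \<pi> y" for x y
  proof -
    have "stretch \<kappa> r 1 = 1"
      using r by (simp add: stretch_def)
    then show ?thesis
      using that collapsing_map_eq_iff[of x y]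
        collapsing_map_eq_iff[of "radial_stretch \<kappa> r x" "radial_stretch \<kappa> r y"]
      by (auto simp: ns)
  qed
  ultimately obtain s where s: "continuous_on (\<pi> ` cball 0 1) s"
    "\<And>y. y \<in> cball 0 1 \<Longrightarrow> s (\<pi> y) = (\<pi> \<circ> radial_stretch \<kappa> r) y"
    using compact_quotient_factor[OF compact_cball collapsing_map_continuous] by metis
  moreover have "s ` sphere 0 1 \<subseteq> sphere 0 1"
    unfolding collapsing_map_image[symmetric] using s(2) by (force simp: ns)
  ultimately show ?thesis
    using that by (simp add: collapsing_map_image)
qed

text \<open>For \<open>\<kappa> > 0\<close> the stretch is strictly increasing and stays below 1 in
  the interior. Hence the induced map identifies no new points, and a continuous bijection between
  compact Hausdorff spaces is a homeomorphism.\<close>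

lemma collapsing_map_stretch_homeomorphism:
  assumes \<kappa>: "0 < \<kappa>" "\<kappa> < 1" and r: "0 < r" "r < 1"
  obtains s s' where "homeomorphism (sphere 0 1) (sphere 0 1) s s'"
    "\<And>y. norm y \<le> 1 \<Longrightarrow> s (\<pi> y) = \<pi> (radial_stretch \<kappa> r y)"
proof -
  have \<kappa>0: "0 \<le> \<kappa>" using \<kappa> by simp
  note ns = norm_radial_stretch[OF \<kappa>0 \<kappa>(2) r] stretch_le_1[OF \<kappa>0 \<kappa>(2) r]
  obtain s where s: "continuous_on (sphere 0 1) s" "s ` sphere 0 1 \<subseteq> sphere 0 1"
    "\<And>y. norm y \<le> 1 \<Longrightarrow> s (\<pi> y) = \<pi> (radial_stretch \<kappa> r y)"
    using collapsing_map_stretch[OF \<kappa>0 \<kappa>(2) r] by metis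
  have "s ` sphere 0 1 = \<pi> ` radial_stretch \<kappa> r ` cball 0 1"
    unfolding collapsing_map_image[symmetric] image_image using s(3) by (intro image_cong) auto
  then have "s ` sphere 0 1 = sphere 0 1"
    by (simp add: radial_stretch_image[OF \<kappa>0 \<kappa>(2) r \<kappa>(1)] collapsing_map_image)
  moreover have "inj_on s (sphere 0 1)"
  proof -
    have inj: "inj_on (stretch \<kappa> r) T" for T
      using stretch_strict_mono[OF \<kappa>0 \<kappa>(2) r \<kappa>(1)] by (metis inj_onI linorder_neqE order_less_irrefl)
    have "x = y \<or> norm x = 1 \<and> norm y = 1"
      if "norm x \<le> 1" "norm y \<le> 1" "s (\<pi> x) = s (\<pi> y)" for x y
    proof -
      have "radial_stretch \<kappa> r x = radial_stretch \<kappa> r y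
          \<or> stretch \<kappa> r (norm x) = 1 \<and> stretch \<kappa> r (norm y) = 1"
        using that collapsing_map_eq_iff[of "radial_stretch \<kappa> r x" "radial_stretch \<kappa> r y"]
        by (simp add: ns s(3))
      moreover have "x = y" if "radial_stretch \<kappa> r x = radial_stretch \<kappa> r y"
        using inj_onD[OF inj_on_radial_stretch[OF \<kappa>0 \<kappa>(2) r inj order_refl] that]
          \<open>norm x \<le> 1\<close> \<open>norm y \<le> 1\<close> by simp
      ultimately show ?thesis
        using stretch_less_1[OF \<kappa>0 \<kappa>(2) r \<kappa>(1)] that(1,2)
        by (metis less_irrefl order_le_less)
    qed
    then show ?thesis
      unfolding collapsing_map_image[symmetric]
      using collapsing_map_eq_iff by (auto simp: inj_on_def)
  qed
  ultimately show ?thesis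
    using homeomorphism_compact[OF compact_sphere s(1)] s(3) that by metis
qed

end

subsection \<open>Near-homeomorphisms\<close>

text \<open>
  A weak form of being a uniform limit of homeomorphisms: \<open>g\<close> agrees with a homeomorphism
  over every closed set that avoids the finitely many points \<open>F\<close> with large fibres. This
  replaces any appeal to the Schoenflies theorem.
\<close>
definition near_homeomorphism :: "'b::topological_space set \<Rightarrow> 'b set \<Rightarrow> ('b \<Rightarrow> 'b) \<Rightarrow> bool" where
  "near_homeomorphism S F g \<longleftrightarrow> continuous_on S g \<and> g ` S \<subseteq> S \<and>
     (\<forall>W. closed W \<longrightarrow> W \<subseteq> S - F \<longrightarrow>
        (\<exists>h h'. homeomorphism S S h h' \<and>
          (\<forall>x\<in>S. (h x \<in> W \<longleftrightarrow> g x \<in> W) \<and> (g x \<in> W \<longrightarrow> h x = g x))))"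

lemma near_homeomorphismE:
  assumes "near_homeomorphism S F g" "closed W" "W \<subseteq> S - F"
  obtains h h' where "homeomorphism S S h h'"
    "\<And>x. x \<in> S \<Longrightarrow> h x \<in> W \<longleftrightarrow> g x \<in> W" "\<And>x. x \<in> S \<Longrightarrow> g x \<in> W \<Longrightarrow> h x = g x"
proof -
  have "\<exists>h h'. homeomorphism S S h h' \<and> (\<forall>x\<in>S. (h x \<in> W \<longleftrightarrow> g x \<in> W) \<and> (g x \<in> W \<longrightarrow> h x = g x))"
    using assms unfolding near_homeomorphism_def by simp
  then show ?thesis
    using that by metis
qed

lemma near_homeomorphism_cong:
  assumes "near_homeomorphism S F f" "\<And>x. x \<in> S \<Longrightarrow> f x = g x"
  shows "near_homeomorphism S F g"
proof -
  have "continuous_on S f = continuous_on S g" "f ` S = g ` S"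
    using assms(2) by (auto intro: continuous_on_cong image_cong)
  then show ?thesis
    using assms unfolding near_homeomorphism_def by (simp cong: ball_cong)
qed

lemma near_homeomorphism_id: "near_homeomorphism S F id"
  unfolding near_homeomorphism_def id_def
  by (intro conjI allI impI exI[of _ "\<lambda>x. x"] homeomorphism_ident) auto

text \<open>First replace \<open>s\<close> by a homeomorphism over \<open>W\<close>, then
  \<open>g\<close> by one over the preimage of \<open>W\<close> under \<open>s\<close>. That
  preimage avoids \<open>F\<close> because \<open>s\<close> fixes \<open>F\<close> and
  \<open>W\<close> misses it.\<close>

lemma near_homeomorphism_compose:
  assumes g: "near_homeomorphism S F g" and s: "near_homeomorphism S G s"
    and fix_F: "\<And>x. x \<in> F \<Longrightarrow> s x = x" and S: "closed S"
  shows "near_homeomorphism S (F \<union> G) (s \<circ> g)"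
proof -
  have cg: "continuous_on S g" and gS: "\<And>x. x \<in> S \<Longrightarrow> g x \<in> S"
    and cs: "continuous_on S s" and sS: "\<And>x. x \<in> S \<Longrightarrow> s x \<in> S"
    using g s unfolding near_homeomorphism_def by blast+
  have "continuous_on S (s \<circ> g)"
    using cg cs gS by (metis continuous_on_compose continuous_on_subset image_subsetI)
  moreover have "(s \<circ> g) ` S \<subseteq> S"
    using gS sS by auto
  moreover have "\<exists>h h'. homeomorphism S S h h' \<and>
      (\<forall>x\<in>S. (h x \<in> W \<longleftrightarrow> (s \<circ> g) x \<in> W) \<and> ((s \<circ> g) x \<in> W \<longrightarrow> h x = (s \<circ> g) x))"
    if W: "closed W" "W \<subseteq> S - (F \<union> G)" for W
  proof -
    have WG: "W \<subseteq> S - G"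
      using W(2) by blast
    obtain k k' where k: "homeomorphism S S k k'"
      "\<And>x. x \<in> S \<Longrightarrow> k x \<in> W \<longleftrightarrow> s x \<in> W" "\<And>x. x \<in> S \<Longrightarrow> s x \<in> W \<Longrightarrow> k x = s x"
      using near_homeomorphismE[OF s W(1) WG] by metis
    have cl: "closed (S \<inter> s -` W)"
      using cs S W(1) by (rule continuous_closed_preimage)
    have sub: "S \<inter> s -` W \<subseteq> S - F"
      using W fix_F by auto
    obtain h h' where h: "homeomorphism S S h h'"
      "\<And>x. x \<in> S \<Longrightarrow> h x \<in> S \<inter> s -` W \<longleftrightarrow> g x \<in> S \<inter> s -` W"
      "\<And>x. x \<in> S \<Longrightarrow> g x \<in> S \<inter> s -` W \<Longrightarrow> h x = g x"
      using near_homeomorphismE[OF g cl sub] by metis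
    have "homeomorphism S S (k \<circ> h) (h' \<circ> k')"
      using homeomorphism_compose[OF h(1) k(1)] .
    moreover have "(k \<circ> h) x \<in> W \<longleftrightarrow> (s \<circ> g) x \<in> W" "(s \<circ> g) x \<in> W \<Longrightarrow> (k \<circ> h) x = (s \<circ> g) x"
      if "x \<in> S" for x
    proof -
      have "h x \<in> S" "g x \<in> S"
        using that homeomorphism_image1[OF h(1)] gS by auto
      then show "(k \<circ> h) x \<in> W \<longleftrightarrow> (s \<circ> g) x \<in> W"
        "(s \<circ> g) x \<in> W \<Longrightarrow> (k \<circ> h) x = (s \<circ> g) x"
        using h(2,3)[OF that] k(2,3) by auto
    qed
    ultimately show ?thesis
      by (intro exI[of _ "k \<circ> h"] exI[of _ "h' \<circ> k'"]) simp
  qed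
  ultimately show ?thesis
    unfolding near_homeomorphism_def by simp
qed

text \<open>Take \<open>W = {y}\<close>: the homeomorphism supplied for it has the same fibre over
  \<open>y\<close> as \<open>g\<close>.\<close>

lemma near_homeomorphism_ex1:
  fixes S :: "'b::t1_space set"
  assumes "near_homeomorphism S F g" "y \<in> S - F"
  shows "\<exists>!x. x \<in> S \<and> g x = y"
proof -
  have y: "closed {y}" "{y} \<subseteq> S - F"
    using assms(2) by auto
  obtain h h' where h: "homeomorphism S S h h'"
    "\<And>x. x \<in> S \<Longrightarrow> h x = y \<longleftrightarrow> g x = y"
    using near_homeomorphismE[OF assms(1) y] by (metis singleton_iff)
  have "y \<in> h ` S"
    using assms homeomorphism_image1[OF h(1)] by blast
  then obtain x where x: "x \<in> S" "h x = y"
    by blast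
  moreover have "x' = x" if "x' \<in> S" "g x' = y" for x'
  proof -
    have "h x' = y"
      using h(2) that by blast
    then show ?thesis
      using homeomorphism_apply1[OF h(1)] that(1) x by metis
  qed
  ultimately show ?thesis
    using h(2) by blast
qed

text \<open>The approximating homeomorphisms are induced by the stretches with small
  \<open>\<kappa> > 0\<close>, which differ from the collapse only close to
  \<open>p\<close>.\<close>

lemma near_homeomorphism_collapse:
  assumes coll: "collapsing_map p \<pi>" and r: "0 < r" "r < 1"
    and s: "continuous_on (sphere 0 1) s" "s ` sphere 0 1 \<subseteq> sphere 0 1"
      "\<And>y. norm y \<le> 1 \<Longrightarrow> s (\<pi> y) = \<pi> (radial_stretch 0 r y)"
  shows "near_homeomorphism (sphere 0 1) {p} s"
  unfolding near_homeomorphism_def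
proof (intro conjI allI impI)
  fix W assume W: "closed W" "W \<subseteq> sphere 0 1 - {p}"
  let ?K = "cball 0 1 \<inter> \<pi> -` W"
  have "compact ?K"
    using collapsing_map_continuous[OF coll] W(1)
    by (simp add: compact_eq_bounded_closed bounded_Int continuous_closed_preimage)
  moreover have "?K \<subseteq> ball 0 1"
    using W(2) collapsing_map_eq_point_iff[OF coll] by fastforce
  ultimately obtain t where t: "0 < t" "t < 1" and tK: "\<And>y. y \<in> ?K \<Longrightarrow> norm y < t"
    using compact_subset_smaller_ball by blast
  \<comment> \<open>Points of the ball over \<open>W\<close> have norm below
    \<open>t = 1 - \<kappa>\<close>, which is the range in which \<open>stretch_agree\<close>
    identifies the two stretches.\<close>
  define \<kappa> where "\<kappa> = 1 - t"
  have \<kappa>: "0 < \<kappa>" "0 \<le> \<kappa>" "\<kappa> < 1"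
    using t by (simp_all add: \<kappa>_def)
  obtain h h' where h: "homeomorphism (sphere 0 1) (sphere 0 1) h h'"
    "\<And>y. norm y \<le> 1 \<Longrightarrow> h (\<pi> y) = \<pi> (radial_stretch \<kappa> r y)"
    using collapsing_map_stretch_homeomorphism[OF coll \<kappa>(1,3) r] by metis
  have "(h x \<in> W \<longleftrightarrow> s x \<in> W) \<and> (s x \<in> W \<longrightarrow> h x = s x)" if x: "x \<in> sphere 0 1" for x
  proof -
    obtain y where y: "norm y \<le> 1" "x = \<pi> y"
      using x collapsing_map_image[OF coll] by (metis imageE mem_cball_0)
    have "radial_stretch \<kappa> r y = radial_stretch 0 r y" if "h x \<in> W \<or> s x \<in> W"
    proof -
      have "radial_stretch \<kappa> r y \<in> cball 0 1" "radial_stretch 0 r y \<in> cball 0 1"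
        using norm_radial_stretch[OF \<kappa>(2,3) r y(1)] norm_radial_stretch[of 0, OF _ _ r y(1)]
          stretch_le_1[OF \<kappa>(2,3) r y(1)] stretch_le_1[of 0, OF _ _ r y(1)] by simp_all
      then have "radial_stretch \<kappa> r y \<in> ?K \<or> radial_stretch 0 r y \<in> ?K"
        using that h(2)[OF y(1)] s(3)[OF y(1)] y(2) by auto
      then have "stretch \<kappa> r (norm y) \<le> 1 - \<kappa> \<or> stretch 0 r (norm y) \<le> 1 - \<kappa>"
        using tK[of "radial_stretch \<kappa> r y"] tK[of "radial_stretch 0 r y"]
          norm_radial_stretch[OF \<kappa>(2,3) r y(1)] norm_radial_stretch[of 0, OF _ _ r y(1)]
        unfolding \<kappa>_def by (smt (verit))
      then show ?thesis
        using stretch_agree[OF \<kappa>(2,3) r norm_ge_zero y(1)] by (simp add: radial_stretch_def)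
    qed
    then show ?thesis
      using h(2)[OF y(1)] s(3)[OF y(1)] y(2) by auto
  qed
  then show "\<exists>h h'. homeomorphism (sphere 0 1) (sphere 0 1) h h' \<and>
      (\<forall>x\<in>sphere 0 1. (h x \<in> W \<longleftrightarrow> s x \<in> W) \<and> (s x \<in> W \<longrightarrow> h x = s x))"
    using h(1) by blast
qed (use s in auto)

subsection \<open>Replacing a point by a ball\<close>

text \<open>\<open>F\<close> holds the points already replaced and \<open>g\<close> is the
  composition so far. \<open>c\<close> is the new innermost factor, \<open>C\<close> the open hole
  over \<open>p\<close>, and \<open>a\<close> a lift of \<open>g \<circ> c\<close> through
  \<open>\<pi>\<close> off the hole. The condition on \<open>F\<close> keeps earlier balls pointwise
  fixed and lets no other point enter them.\<close>

definition blow_up :: "'a::euclidean_space \<times> real \<Rightarrow> ('a \<Rightarrow> 'a \<times> real) \<Rightarrow> ('a \<times> real) set \<Rightarrow>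
    ('a \<times> real \<Rightarrow> 'a \<times> real) \<Rightarrow> ('a \<times> real \<Rightarrow> 'a \<times> real) \<Rightarrow> ('a \<times> real) set \<Rightarrow>
    ('a \<times> real \<Rightarrow> 'a) \<Rightarrow> bool" where
  "blow_up p \<pi> F g c C a \<longleftrightarrow>
     near_homeomorphism (sphere 0 1) (insert p F) (g \<circ> c) \<and>
     continuous_on (sphere 0 1) c \<and> c ` sphere 0 1 \<subseteq> sphere 0 1 \<and>
     (\<forall>x\<in>sphere 0 1. g x \<in> F \<or> g (c x) \<in> F \<longrightarrow> c x = x) \<and>
     openin (top_of_set (sphere 0 1)) C \<and> tame_ball C \<and>
     (\<forall>x\<in>sphere 0 1. g (c x) = p \<longleftrightarrow> x \<in> closure C) \<and>
     continuous_on (sphere 0 1 - C) a \<and>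
     (\<forall>x\<in>sphere 0 1 - C. norm (a x) \<le> 1 \<and> \<pi> (a x) = g (c x)) \<and>
     bij_betw a (closure C - C) (sphere 0 1)"

text \<open>Let \<open>s\<close> collapse a ball near \<open>p\<close>. A homeomorphism
  \<open>h\<close> agreeing with \<open>g\<close> over a neighbourhood \<open>W\<close> of
  \<open>p\<close> turns \<open>s \<circ> g\<close> into \<open>g \<circ> c\<close> with
  \<open>c = h' \<circ> s \<circ> h\<close>. The fibre of \<open>g\<close> over \<open>p\<close> is
  one point \<open>q\<close>, so a small \<open>W\<close> makes \<open>c\<close> move points
  little.\<close>

lemma blow_up_step:
  fixes p :: "'a::euclidean_space \<times> real" and \<pi> :: "'a \<Rightarrow> 'a \<times> real"
  assumes near: "near_homeomorphism (sphere 0 1) F g" and F: "finite F" "F \<subseteq> sphere 0 1"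
    and coll: "collapsing_map p \<pi>" and p: "p \<in> sphere 0 1 - F" and \<eta>: "\<eta> > 0"
  obtains c C a where "blow_up p \<pi> F g c C a" "\<And>x. x \<in> sphere 0 1 \<Longrightarrow> dist (c x) x < \<eta>"
    "diameter (closure C) \<le> \<eta>"
proof -
  let ?S = "sphere 0 1 :: ('a \<times> real) set"
  let ?D = "cball 0 1 :: 'a set"
  note \<pi>_cont = collapsing_map_continuous[OF coll] and \<pi>_im = collapsing_map_image[OF coll]
    and \<pi>_S = collapsing_map_in_sphere[OF coll] and \<pi>_eq = collapsing_map_eq_iff[OF coll]
    and \<pi>_p = collapsing_map_eq_point_iff[OF coll]
  have g: "continuous_on ?S g" and gS: "\<And>x. x \<in> ?S \<Longrightarrow> g x \<in> ?S"
    using near unfolding near_homeomorphism_def by blast+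
  obtain q where q: "q \<in> ?S" "g q = p" and q1: "\<And>x. x \<in> ?S \<Longrightarrow> g x = p \<Longrightarrow> x = q"
    using near_homeomorphism_ex1[OF near p] by metis
  \<comment> \<open>\<open>W\<close> has to avoid \<open>F\<close>, to leave earlier balls alone,
    and the image of everything far from \<open>q\<close>, to make its preimage small. Since
    \<open>q\<close> is the only point over \<open>p\<close>, this set misses
    \<open>p\<close>.\<close>
  define K where "K = F \<union> g ` (?S - ball q (\<eta> / 2))"
  have "compact K"
    unfolding K_def
    by (intro compact_Un[OF finite_imp_compact[OF F(1)]] compact_continuous_image
        continuous_on_subset[OF g] compact_diff) auto
  moreover have pK: "p \<notin> K"
    unfolding K_def using p q1 \<eta> by auto
  ultimately have "compact (?D \<inter> \<pi> -` K)"
    using \<pi>_cont by (simp add: compact_eq_bounded_closed bounded_Int continuous_closed_preimage)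
  moreover have "?D \<inter> \<pi> -` K \<subseteq> ball 0 1"
    using pK \<pi>_p by (force simp: order_le_less)
  ultimately obtain r where r: "0 < r" "r < 1" and rK: "\<And>y. y \<in> ?D \<inter> \<pi> -` K \<Longrightarrow> norm y < r"
    using compact_subset_smaller_ball by blast
  define W where "W = \<pi> ` (?D - ball 0 r)"
  \<comment> \<open>The radius at which \<open>stretch 0 r\<close> first reaches 1; the shell from
    \<open>r1\<close> to 1 is what \<open>s\<close> collapses to \<open>p\<close>.\<close>
  define r1 where "r1 = (1 + r) / 2"
  have r1: "0 < r1" "r1 < 1" "r < r1"
    using r by (simp_all add: r1_def)
  have WK: "W \<inter> K = {}"
    using rK unfolding W_def by force
  have "compact W"
    unfolding W_def by (intro compact_continuous_image continuous_on_subset[OF \<pi>_cont] compact_diff) auto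
  then have "closed W"
    by (rule compact_imp_closed)
  have \<pi>W: "\<pi> y \<in> W \<longleftrightarrow> r \<le> norm y" if "norm y \<le> 1" for y
  proof
    assume "\<pi> y \<in> W"
    then obtain z where "\<pi> y = \<pi> z" "norm z \<le> 1" "r \<le> norm z"
      unfolding W_def by auto
    then show "r \<le> norm y"
      using \<pi>_eq[OF that, of z] r by auto
  qed (use that in \<open>auto simp: W_def\<close>)
  have WS: "W \<subseteq> ?S - F"
    using WK \<pi>_S unfolding W_def K_def by auto
  have V: "x \<in> ball q (\<eta> / 2)" if "x \<in> ?S" "g x \<in> W" for x
    using WK that unfolding K_def by blast
  obtain h h' where h: "homeomorphism ?S ?S h h'"
    and hW: "\<And>x. x \<in> ?S \<Longrightarrow> h x \<in> W \<longleftrightarrow> g x \<in> W" "\<And>x. x \<in> ?S \<Longrightarrow> g x \<in> W \<Longrightarrow> h x = g x"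
    using near_homeomorphismE[OF near \<open>closed W\<close> WS] by metis
  have hS: "h x \<in> ?S" "h' x \<in> ?S" "h' (h x) = x" "h (h' x) = x" if "x \<in> ?S" for x
    using h that unfolding homeomorphism_def by auto
  have h'_image: "h' ` T = {x \<in> ?S. h x \<in> T}" if T: "T \<subseteq> ?S" for T
  proof (intro set_eqI iffI)
    fix x assume "x \<in> h' ` T"
    then obtain y where "y \<in> T" "x = h' y" ..
    then show "x \<in> {x \<in> ?S. h x \<in> T}"
      using hS(2,4)[of y] T by (metis (mono_tags, lifting) mem_Collect_eq subsetD)
  next
    fix x assume "x \<in> {x \<in> ?S. h x \<in> T}"
    then show "x \<in> h' ` T"
      using hS(3)[of x] by (metis (mono_tags, lifting) imageI mem_Collect_eq)
  qed
  have h_cont: "continuous_on ?S h" "continuous_on ?S h'"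
    using h unfolding homeomorphism_def by auto

  \<comment> \<open>The collapse near \<open>p\<close> and its conjugate\<close>
  let ?R = "radial_stretch 0 r :: 'a \<Rightarrow> 'a"
  have nR: "norm (?R y) = stretch 0 r (norm y)" "norm (?R y) \<le> 1" "norm y \<le> norm (?R y)"
    if "norm y \<le> 1" for y
    using norm_radial_stretch[of 0 r y] stretch_le_1[of 0 r "norm y"] stretch_ge[of 0 r "norm y"] r that
    by simp_all
  obtain s where s: "continuous_on ?S s" "s ` ?S \<subseteq> ?S"
    and s\<pi>: "\<And>y. norm y \<le> 1 \<Longrightarrow> s (\<pi> y) = \<pi> (?R y)"
    using collapsing_map_stretch[OF coll, of 0 r] r by (metis order_refl zero_less_one)
  have sW: "s x \<in> W" if x: "x \<in> W" for x
  proof -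
    obtain y where y: "norm y \<le> 1" "x = \<pi> y" "r \<le> norm y"
      using x unfolding W_def by auto
    then show ?thesis
      using s\<pi>[OF y(1)] nR[OF y(1)] \<pi>W[of "?R y"] by simp
  qed
  have s_id: "s x = x" if "x \<in> ?S" "x \<notin> W" for x
  proof -
    obtain y where y: "norm y \<le> 1" "x = \<pi> y"
      using \<open>x \<in> ?S\<close> \<pi>_im by (metis imageE mem_cball_0)
    then have "norm y \<le> r"
      using \<pi>W that(2) by force
    then show ?thesis
      using y s\<pi> radial_stretch_inner[of 0 r y] r by simp
  qed

  define c where "c = h' \<circ> s \<circ> h"
  have cS: "c x \<in> ?S" and hc: "h (c x) = s (h x)" if "x \<in> ?S" for x
  proof -
    have "s (h x) \<in> ?S"
      using hS(1)[OF that] s(2) by blast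
    then show "c x \<in> ?S" "h (c x) = s (h x)"
      unfolding c_def comp_apply by (rule hS)+
  qed
  have c_id: "c x = x" if "x \<in> ?S" "g x \<notin> W" for x
    unfolding c_def comp_apply using s_id[OF hS(1)] hW(1) hS(3) that by metis
  \<comment> \<open>Over \<open>W\<close>, which \<open>s\<close> maps into itself, \<open>h\<close>
    and \<open>g\<close> coincide; elsewhere \<open>c\<close> and \<open>s\<close> are both the
    identity.\<close>
  have gc: "g (c x) = s (g x)" if x: "x \<in> ?S" for x
  proof (cases "g x \<in> W")
    case True
    then have "h (c x) = s (g x)" "s (g x) \<in> W"
      using hc[OF x] hW(2)[OF x] sW by auto
    then show ?thesis
      using hW[OF cS[OF x]] by metis
  next
    case False
    then show ?thesis
      using c_id[OF x] s_id[OF gS[OF x]] by metis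
  qed

  \<comment> \<open>The hole and its closure\<close>
  define E where "E = \<pi> ` cball 0 r1"
  have "compact E"
    unfolding E_def using r1 by (intro compact_continuous_image continuous_on_subset[OF \<pi>_cont]) auto
  have ES: "E \<subseteq> ?S"
    unfolding E_def using \<pi>_S r1 by auto
  have \<pi>E: "\<pi> y \<in> E \<longleftrightarrow> norm y \<le> r1" if "norm y \<le> 1" for y
  proof
    assume "\<pi> y \<in> E"
    then obtain z where "\<pi> y = \<pi> z" "norm z \<le> r1"
      unfolding E_def by auto
    then show "norm y \<le> r1"
      using \<pi>_eq[OF that, of z] r1 by auto
  qed (auto simp: E_def)
  define A where "A = ?D - ball 0 r1"
  have \<pi>A: "\<pi> y \<in> \<pi> ` A \<longleftrightarrow> r1 \<le> norm y" if "norm y \<le> 1" for y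
  proof
    assume "\<pi> y \<in> \<pi> ` A"
    then obtain z where "\<pi> y = \<pi> z" "norm z \<le> 1" "r1 \<le> norm z"
      unfolding A_def by auto
    then show "r1 \<le> norm y"
      using \<pi>_eq[OF that, of z] r1 by auto
  qed (use that in \<open>auto simp: A_def\<close>)
  have AW: "\<pi> ` A \<subseteq> W"
    using r1 unfolding A_def W_def by auto
  have compA: "compact A"
    unfolding A_def by (intro compact_diff) auto
  have AD: "A \<subseteq> ?D"
    by (auto simp: A_def)
  have h'\<pi>: "continuous_on ?D (h' \<circ> \<pi>)"
    by (intro continuous_on_compose \<pi>_cont) (simp add: \<pi>_im h_cont)

  \<comment> \<open>The hole is pulled back by \<open>h\<close> and not by \<open>g\<close>, so that
    its shape is known although \<open>g\<close> may collapse earlier balls.\<close>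
  define C where "C = {x \<in> ?S. h x \<notin> E}"
  have C_open: "openin (top_of_set ?S) C"
  proof -
    have "openin (top_of_set ?S) (?S \<inter> h -` (- E))"
      using h_cont(1) compact_imp_closed[OF \<open>compact E\<close>]
      by (intro continuous_openin_preimage_gen) auto
    moreover have "C = ?S \<inter> h -` (- E)"
      by (auto simp: C_def)
    ultimately show ?thesis by simp
  qed
  have Cc_eq: "?S - C = (h' \<circ> \<pi>) ` cball 0 r1"
  proof -
    have "?S - C = h' ` E"
      unfolding h'_image[OF ES] by (auto simp: C_def)
    then show ?thesis
      by (simp add: E_def image_comp)
  qed
  have B_eq: "(h' \<circ> \<pi>) ` A = {x \<in> ?S. h x \<in> \<pi> ` A}"
  proof -
    have "\<pi> ` A \<subseteq> ?S"
      using AD \<pi>_im by blast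
    then have "h' ` \<pi> ` A = {x \<in> ?S. h x \<in> \<pi> ` A}"
      by (rule h'_image)
    then show ?thesis
      by (simp add: image_comp)
  qed
  have cl_C: "closure C = {x \<in> ?S. h x \<in> \<pi> ` A}"
  proof
    have "compact ((h' \<circ> \<pi>) ` A)"
      by (intro compact_continuous_image continuous_on_subset[OF h'\<pi>] compA AD)
    moreover have "C \<subseteq> {x \<in> ?S. h x \<in> \<pi> ` A}"
    proof
      fix x assume x: "x \<in> C"
      then have "h x \<in> ?S"
        using hS(1) unfolding C_def by blast
      then obtain y where y: "norm y \<le> 1" "h x = \<pi> y"
        using \<pi>_im by (metis imageE mem_cball_0)
      then show "x \<in> {x \<in> ?S. h x \<in> \<pi> ` A}"
        using x \<pi>E \<pi>A unfolding C_def by simp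
    qed
    ultimately show "closure C \<subseteq> {x \<in> ?S. h x \<in> \<pi> ` A}"
      unfolding B_eq[symmetric] by (simp add: closure_minimal compact_imp_closed)
    let ?A0 = "{y. r1 < norm y \<and> norm y \<le> 1} :: 'a set"
    have A0: "A \<subseteq> closure ?A0"
    proof
      fix y assume y: "y \<in> A"
      show "y \<in> closure ?A0"
      proof (cases "norm y = r1")
        case True
        \<comment> \<open>Points of the inner sphere are approached from outside. The norms stay at
          most 1 because \<open>(2 - r1) * r1 = 1 - (1 - r1)^2\<close>.\<close>
        let ?f = "\<lambda>n. (1 + (1 - r1) / real (Suc n)) *\<^sub>R y"
        have "norm (?f n) = (1 + (1 - r1) / real (Suc n)) * r1" for n
          using True r1 by simp
        moreover have "r1 < (1 + (1 - r1) / real (Suc n)) * r1" for n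
          using r1 by (simp add: algebra_simps)
        moreover have "(1 + (1 - r1) / real (Suc n)) * r1 \<le> 1" for n
        proof -
          have "(1 - r1) / real (Suc n) \<le> 1 - r1"
            using r1 by (simp add: divide_le_eq)
          then have "(1 + (1 - r1) / real (Suc n)) * r1 \<le> (1 + (1 - r1)) * r1"
            using r1 by (intro mult_right_mono) auto
          also have "\<dots> \<le> 1"
            using zero_le_power2[of "1 - r1"] by (simp add: power2_eq_square algebra_simps)
          finally show ?thesis .
        qed
        ultimately have "\<And>n. ?f n \<in> ?A0"
          by simp
        moreover have "?f \<longlonglongrightarrow> (1 + 0) *\<^sub>R y"
          by (intro tendsto_intros LIMSEQ_Suc[OF lim_const_over_n])
        ultimately show ?thesis
          unfolding closure_sequential by (intro exI[of _ ?f]) simp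
      next
        case False
        then have "y \<in> ?A0"
          using y by (auto simp: A_def)
        then show ?thesis
          by (rule subsetD[OF closure_subset])
      qed
    qed
    have "closure ?A0 \<subseteq> ?D"
      by (rule closure_minimal) auto
    moreover have "(h' \<circ> \<pi>) ` ?A0 \<subseteq> closure C"
    proof -
      have "(h' \<circ> \<pi>) y \<in> C" if "y \<in> ?A0" for y
      proof -
        have "\<pi> y \<in> ?S" "\<pi> y \<notin> E"
          using that \<pi>_S[of y] \<pi>E[of y] by auto
        then show ?thesis
          using hS(2,4) unfolding C_def by simp
      qed
      then show ?thesis
        using closure_subset by blast
    qed
    ultimately have "(h' \<circ> \<pi>) ` closure ?A0 \<subseteq> closure C"
      by (intro image_closure_subset continuous_on_subset[OF h'\<pi>]) auto
    then show "{x \<in> ?S. h x \<in> \<pi> ` A} \<subseteq> closure C"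
      unfolding B_eq[symmetric] using A0 by blast
  qed
  have clC_W: "h x = g x" "g x \<in> W" if "x \<in> closure C" for x
    using that AW hW unfolding cl_C by blast+
  have h'\<pi>_eq: "(h' \<circ> \<pi>) x = (h' \<circ> \<pi>) y \<longleftrightarrow> x = y \<or> norm x = 1 \<and> norm y = 1"
    if "norm x \<le> 1" "norm y \<le> 1" for x y
  proof -
    have "(h' \<circ> \<pi>) x = (h' \<circ> \<pi>) y \<longleftrightarrow> \<pi> x = \<pi> y"
      using hS(4) \<pi>_S that by (metis comp_apply)
    then show ?thesis
      using \<pi>_eq that by simp
  qed

  \<comment> \<open>Tameness of the hole\<close>
  have tame: "tame_ball C"
    unfolding tame_ball_def
  proof (intro conjI disjI1 C_open)
    \<comment> \<open>The closure of \<open>C\<close> is the shell \<open>A\<close> with its outer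
      sphere collapsed by \<open>\<pi>\<close>; \<open>e\<close> has the same fibres on
      \<open>A\<close> and maps it onto the unit ball.\<close>
    define e where "e = (\<lambda>y::'a. ((1 - norm y) / ((1 - r1) * norm y)) *\<^sub>R y)"
    note e = collapse_outer_sphere[OF r1(1,2), where 'a='a, folded e_def A_def]
    have "(h' \<circ> \<pi>) ` A homeomorphic e ` A"
    proof (rule homeomorphic_compact_quotients[OF compA])
      show "continuous_on A (h' \<circ> \<pi>)"
        using continuous_on_subset[OF h'\<pi> AD] .
      show "(h' \<circ> \<pi>) x = (h' \<circ> \<pi>) y \<longleftrightarrow> e x = e y" if "x \<in> A" "y \<in> A" for x y
      proof -
        have "norm x \<le> 1" "norm y \<le> 1"
          using that AD by auto
        then show ?thesis
          using h'\<pi>_eq[of x y] e(3)[OF that] unfolding e_def by blast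
      qed
    qed (rule e)
    then show "closure C homeomorphic cball (0::'a) 1"
      unfolding cl_C B_eq[symmetric] e(2) .
    \<comment> \<open>The complement of the hole is an embedded ball, since \<open>r1 < 1\<close>
      keeps clear of the collapsed boundary.\<close>
    have "inj_on (h' \<circ> \<pi>) (cball 0 r1)"
      using h'\<pi>_eq r1 by (auto simp: inj_on_def)
    moreover have "continuous_on (cball 0 r1) (h' \<circ> \<pi>)"
      using r1 by (intro continuous_on_subset[OF h'\<pi>]) auto
    ultimately have "cball (0::'a) r1 homeomorphic ?S - C"
      using homeomorphic_compact[OF compact_cball _ Cc_eq[symmetric]] by blast
    then have "?S - C homeomorphic cball (0::'a) 1"
      using r1 homeomorphic_balls(2)[of r1 1 "0::'a" "0::'a"]
      by (meson homeomorphic_sym homeomorphic_trans zero_less_one)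
    then show "?S - top_of_set ?S interior_of C homeomorphic cball (0::'a) 1"
      using C_open by (simp add: interior_of_openin)
  qed
  have clC_ball: "closure C \<subseteq> ball q (\<eta> / 2)"
    using V clC_W cl_C by blast
  have "diameter (closure C) \<le> diameter (ball q (\<eta> / 2))"
    using clC_ball by (intro diameter_subset) auto
  then have diam: "diameter (closure C) \<le> \<eta>"
    using \<eta> by simp

  \<comment> \<open>The lift through the collapsing map\<close>
  have "inj_on \<pi> (cball 0 r1)"
    using \<pi>_eq r1 by (auto simp: inj_on_def)
  moreover have "continuous_on (cball 0 r1) \<pi>"
    using r1 by (intro continuous_on_subset[OF \<pi>_cont]) auto
  ultimately obtain \<sigma> where \<sigma>: "homeomorphism (cball 0 r1) E \<pi> \<sigma>"
    using homeomorphism_compact[OF compact_cball _ E_def[symmetric]] by metis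
  have \<sigma>_cont: "continuous_on E \<sigma>"
    using \<sigma> unfolding homeomorphism_def by blast
  have \<sigma>E: "norm (\<sigma> x) \<le> r1 \<and> \<pi> (\<sigma> x) = x" if "x \<in> E" for x
    using that homeomorphism_image2[OF \<sigma>] homeomorphism_apply2[OF \<sigma>] by (metis imageI mem_cball_0)
  have \<sigma>\<pi>: "\<sigma> (\<pi> y) = y" if "norm y \<le> r1" for y
    using that homeomorphism_apply1[OF \<sigma>] by simp
  \<comment> \<open>Off the hole \<open>g\<close> takes values in \<open>E\<close>, where
    \<open>\<sigma>\<close> inverts \<open>\<pi>\<close>. Stretching this lift of \<open>g\<close>
    gives a lift of \<open>s \<circ> g = g \<circ> c\<close>; it carries radius \<open>r1\<close> to
    radius 1, so the boundary of the hole is not collapsed.\<close>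
  define a where "a = ?R \<circ> \<sigma> \<circ> g"
  have gE: "g x \<in> E" if x: "x \<in> ?S - C" for x
  proof (cases "g x \<in> W")
    case True
    then show ?thesis
      using hW(2) that by (simp add: C_def)
  next
    case False
    obtain y where y: "norm y \<le> 1" "g x = \<pi> y"
      using gS[of x] x \<pi>_im by (metis DiffD1 imageE mem_cball_0)
    then show ?thesis
      using False \<pi>W \<pi>E r1 by simp
  qed
  have a_cont: "continuous_on (?S - C) a"
  proof -
    have "continuous_on ?D ?R"
      using r by (intro continuous_on_radial_stretch) auto
    then have "continuous_on (\<sigma> ` g ` (?S - C)) ?R"
    proof (rule continuous_on_subset)
      have "norm (\<sigma> (g x)) \<le> 1" if "x \<in> ?S - C" for x
        using \<sigma>E[OF gE[OF that]] r1 by simp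
      then show "\<sigma> ` g ` (?S - C) \<subseteq> ?D"
        by (metis (no_types, lifting) image_image image_subsetI mem_cball_0)
    qed
    moreover have "continuous_on (g ` (?S - C)) \<sigma>"
      by (rule continuous_on_subset[OF \<sigma>_cont]) (use gE in blast)
    ultimately show ?thesis
      unfolding a_def comp_assoc
      by (intro continuous_on_compose continuous_on_subset[OF g]) (auto simp: image_comp)
  qed
  have a_lift: "norm (a x) \<le> 1 \<and> \<pi> (a x) = g (c x)" if "x \<in> ?S - C" for x
  proof -
    have "norm (\<sigma> (g x)) \<le> 1" "\<pi> (\<sigma> (g x)) = g x"
      using \<sigma>E[OF gE[OF that]] r1 by auto
    then show ?thesis
      using nR(2) s\<pi> gc[of x] that unfolding a_def by (metis DiffD1 comp_apply)
  qed
  have gc_p: "g (c x) = p \<longleftrightarrow> x \<in> closure C" if x: "x \<in> ?S" for x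
  proof -
    obtain y where y: "norm y \<le> 1" "g x = \<pi> y"
      using gS[OF x] \<pi>_im by (metis imageE mem_cball_0)
    have "g (c x) = p \<longleftrightarrow> stretch 0 r (norm y) = 1"
      using gc[OF x] y s\<pi> \<pi>_p nR by simp
    also have "\<dots> \<longleftrightarrow> g x \<in> \<pi> ` A"
      using y \<pi>A stretch_0_eq_1_iff[OF r] r by (auto simp: r1_def)
    also have "\<dots> \<longleftrightarrow> x \<in> closure C"
    proof -
      have "h x = g x" if "g x \<in> \<pi> ` A \<or> h x \<in> \<pi> ` A"
        using that AW hW[OF x] by (metis subsetD)
      then show ?thesis
        using x unfolding cl_C by (metis (mono_tags, lifting) mem_Collect_eq)
    qed
    finally show ?thesis .
  qed
  have a_bij: "bij_betw a (closure C - C) (sphere 0 1)"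
  \<comment> \<open>The inverse shrinks a unit vector to radius \<open>r1\<close>, where the stretch
    is scaling by \<open>1 / r1\<close>, and returns to the domain by \<open>h'\<close>.\<close>
  proof (rule bij_betw_byWitness[where f' = "\<lambda>z. h' (\<pi> (r1 *\<^sub>R z))"])
    have R_r1: "?R y = (1 / r1) *\<^sub>R y" if "norm y = r1" for y
    proof -
      have "stretch 0 r r1 = 1"
        using stretch_0_eq_1_iff[OF r, of r1] by (simp add: r1_def)
      then show ?thesis
        unfolding radial_stretch_def that by simp
    qed
    have bd: "\<exists>y. norm y = r1 \<and> h x = \<pi> y \<and> a x = (1 / r1) *\<^sub>R y \<and> x \<in> ?S"
      if "x \<in> closure C - C" for x
    proof -
      have x: "x \<in> ?S" "h x \<in> \<pi> ` A"
        using that unfolding cl_C by blast+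
      then have "h x \<in> E"
        using that unfolding C_def by blast
      from x(2) obtain y where y: "norm y \<le> 1" "h x = \<pi> y"
        unfolding A_def by auto
      then have n: "norm y = r1"
        using \<pi>A[OF y(1)] \<pi>E[OF y(1)] x \<open>h x \<in> E\<close> by simp
      have "g x = \<pi> y"
        using clC_W[of x] that y by simp
      then show ?thesis
        using n y x R_r1 \<sigma>\<pi> unfolding a_def by auto
    qed
    show "\<forall>x\<in>closure C - C. h' (\<pi> (r1 *\<^sub>R a x)) = x"
    proof
      fix x assume "x \<in> closure C - C"
      then obtain y where "h x = \<pi> y" "a x = (1 / r1) *\<^sub>R y" "x \<in> ?S"
        using bd by blast
      then show "h' (\<pi> (r1 *\<^sub>R a x)) = x"
        using r1 hS(3)[of x] by simp
    qed
    show "a ` (closure C - C) \<subseteq> sphere 0 1"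
      using bd r1 by fastforce
    have w: "h' (\<pi> (r1 *\<^sub>R z)) \<in> closure C - C" "h (h' (\<pi> (r1 *\<^sub>R z))) = \<pi> (r1 *\<^sub>R z)"
      if "z \<in> sphere 0 1" for z
    proof -
      have n: "norm (r1 *\<^sub>R z) = r1"
        using that r1 by simp
      have "\<pi> (r1 *\<^sub>R z) \<in> ?S"
        using n \<pi>_S r1 by simp
      show "h (h' (\<pi> (r1 *\<^sub>R z))) = \<pi> (r1 *\<^sub>R z)"
        and "h' (\<pi> (r1 *\<^sub>R z)) \<in> closure C - C"
      proof -
        have "\<pi> (r1 *\<^sub>R z) \<in> \<pi> ` A" "\<pi> (r1 *\<^sub>R z) \<in> E"
          using \<pi>A[of "r1 *\<^sub>R z"] \<pi>E[of "r1 *\<^sub>R z"] n r1 by auto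
        then show "h (h' (\<pi> (r1 *\<^sub>R z))) = \<pi> (r1 *\<^sub>R z)"
          and "h' (\<pi> (r1 *\<^sub>R z)) \<in> closure C - C"
          using hS(2,4)[OF \<open>\<pi> (r1 *\<^sub>R z) \<in> ?S\<close>] unfolding cl_C unfolding C_def by auto
      qed
    qed
    show "(\<lambda>z. h' (\<pi> (r1 *\<^sub>R z))) ` sphere 0 1 \<subseteq> closure C - C"
      using w(1) by blast
    show "\<forall>z\<in>sphere 0 1. a (h' (\<pi> (r1 *\<^sub>R z))) = z"
    proof
      fix z :: 'a assume z: "z \<in> sphere 0 1"
      then have n: "norm (r1 *\<^sub>R z) = r1"
        using r1 by simp
      have "g (h' (\<pi> (r1 *\<^sub>R z))) = \<pi> (r1 *\<^sub>R z)"
        using clC_W(1)[of "h' (\<pi> (r1 *\<^sub>R z))"] w[OF z] by simp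
      then show "a (h' (\<pi> (r1 *\<^sub>R z))) = z"
        using \<sigma>\<pi>[of "r1 *\<^sub>R z"] R_r1[OF n] n r1 unfolding a_def by simp
    qed
  qed

  \<comment> \<open>Control of the new factor\<close>
  have near_gc: "near_homeomorphism ?S (insert p F) (g \<circ> c)"
  proof -
    have "near_homeomorphism ?S (F \<union> {p}) (s \<circ> g)"
    proof (rule near_homeomorphism_compose[OF near _ _ closed_sphere])
      show "near_homeomorphism ?S {p} s"
        using near_homeomorphism_collapse[OF coll r s s\<pi>] .
      show "s x = x" if "x \<in> F" for x
        using s_id WS that F(2) by blast
    qed
    then have "near_homeomorphism ?S (insert p F) (s \<circ> g)"
      by simp
    then show ?thesis
      by (rule near_homeomorphism_cong) (simp add: gc)
  qed
  have c_cont: "continuous_on ?S c"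
  proof -
    have "continuous_on (h ` ?S) (h' \<circ> s)"
      unfolding homeomorphism_image1[OF h]
      by (intro continuous_on_compose s continuous_on_subset[OF h_cont(2) s(2)])
    then show ?thesis
      unfolding c_def by (rule continuous_on_compose[OF h_cont(1)])
  qed
  have c_image: "c ` ?S \<subseteq> ?S"
    using cS by blast
  have c_fix: "c x = x" if x: "x \<in> ?S" and "g x \<in> F \<or> g (c x) \<in> F" for x
  proof (rule c_id[OF x])
    \<comment> \<open>\<open>s\<close> maps \<open>W\<close> into itself and \<open>F\<close> misses
      \<open>W\<close>; so \<open>g x \<in> W\<close> would keep both \<open>g x\<close> and
      \<open>g (c x)\<close> out of \<open>F\<close>.\<close>
    show "g x \<notin> W"
      using that(2) gc[OF x] sW WS by (metis DiffD2 subsetD)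
  qed
  show thesis
  proof (rule that[OF _ _ diam])
    show "blow_up p \<pi> F g c C a"
      unfolding blow_up_def
      by (intro conjI[OF near_gc] conjI[OF c_cont] conjI[OF c_image] conjI[OF C_open] conjI[OF tame]
          conjI[OF a_cont] conjI ballI impI c_fix gc_p) (use a_lift a_bij in blast)+
    show "dist (c x) x < \<eta>" if x: "x \<in> ?S" for x
    proof (cases "g x \<in> W")
      case True
      \<comment> \<open>Both \<open>x\<close> and \<open>c x\<close> lie over \<open>W\<close>,
        hence in the ball of radius \<open>\<eta> / 2\<close> about \<open>q\<close>.\<close>
      then have "g (c x) \<in> W"
        using gc[OF x] sW by simp
      then have "dist q (c x) < \<eta> / 2" "dist q x < \<eta> / 2"
        using V cS[OF x] x True by auto
      then show ?thesis
        using dist_triangle_half_r by blast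
    qed (use c_id x \<eta> in simp)
  qed
qed

subsection \<open>Infinite compositions\<close>

lemma uniform_limit_geometric:
  fixes f :: "nat \<Rightarrow> 'x \<Rightarrow> 'b::banach"
  assumes step: "\<And>n x. x \<in> S \<Longrightarrow> dist (f (Suc n) x) (f n x) \<le> b * (1/2) ^ n"
  obtains l where "uniform_limit S f l sequentially"
    "\<And>n x. x \<in> S \<Longrightarrow> dist (l x) (f n x) \<le> 2 * b * (1/2) ^ n"
proof -
  define l where "l = (\<lambda>x. f 0 x + (\<Sum>i. f (Suc i) x - f i x))"
  have "uniform_limit S (\<lambda>n x. \<Sum>i<n. f (Suc i) x - f i x) (\<lambda>x. \<Sum>i. f (Suc i) x - f i x) sequentially"
    using step by (intro Weierstrass_m_test[where M = "\<lambda>n. b * (1/2) ^ n"] summable_mult summable_geometric)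
      (simp_all add: dist_norm)
  then have "uniform_limit S (\<lambda>n x. f 0 x + (\<Sum>i<n. f (Suc i) x - f i x)) l sequentially"
    unfolding l_def by (intro uniform_limit_add uniform_limit_const)
  moreover have "f 0 x + (\<Sum>i<n. f (Suc i) x - f i x) = f n x" for n x
    using sum_lessThan_telescope[of "\<lambda>i. f i x" n] by simp
  ultimately have lim: "uniform_limit S f l sequentially"
    by simp
  moreover have "dist (l x) (f n x) \<le> 2 * b * (1/2) ^ n" if x: "x \<in> S" for n x
  proof -
    have b: "0 \<le> b"
      using order_trans[OF zero_le_dist step[OF x, of 0]] by simp
    \<comment> \<open>Subtracting the remaining geometric tail makes the induction close.\<close>
    have "dist (f (m + n) x) (f n x) \<le> 2 * b * (1/2) ^ n - 2 * b * (1/2) ^ (m + n)" for m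
    proof (induction m)
      case (Suc m)
      then show ?case
        using step[OF x, of "m + n"] dist_triangle[of "f (Suc m + n) x" "f n x" "f (m + n) x"]
        by simp
    qed simp
    moreover have "0 \<le> 2 * b * (1/2) ^ (m + n)" for m
      using b by simp
    ultimately have "dist (f (m + n) x) (f n x) \<le> 2 * b * (1/2) ^ n" for m
      by (smt (verit))
    moreover have "(\<lambda>m. f (m + n) x) \<longlonglongrightarrow> l x"
      using tendsto_uniform_limitI[OF lim x] by (rule LIMSEQ_ignore_initial_segment)
    then have "(\<lambda>m. dist (f (m + n) x) (f n x)) \<longlonglongrightarrow> dist (l x) (f n x)"
      by (intro tendsto_intros)
    ultimately show ?thesis
      by (intro LIMSEQ_le_const2) auto
  qed
  ultimately show ?thesis
    using that by blast
qed

lemma tendsto_geometric_bound: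
  fixes u :: "nat \<Rightarrow> 'b::metric_space"
  assumes "\<And>k. dist (u k) y \<le> b * (1/2) ^ k"
  shows "u \<longlonglongrightarrow> y"
proof -
  have lim: "(\<lambda>k. b * (1/2) ^ k :: real) \<longlonglongrightarrow> 0"
    by (intro tendsto_mult_right_zero LIMSEQ_power_zero) simp
  have "(\<lambda>k. dist (u k) y) \<longlonglongrightarrow> 0"
  proof (rule tendsto_sandwich[OF _ _ tendsto_const lim])
    show "\<forall>\<^sub>F k in sequentially. dist (u k) y \<le> b * (1/2) ^ k"
      using assms by (rule always_eventually[OF allI])
  qed simp
  then show ?thesis
    by (rule tendsto_dist_iff[THEN iffD2])
qed

text \<open>\<open>c j \<circ> \<dots> \<circ> c (j + n - 1)\<close>: new factors enter on the
  inside, so convergence depends on the moduli of continuity of the earlier compositions.\<close>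

primrec comp_from :: "(nat \<Rightarrow> 'b \<Rightarrow> 'b) \<Rightarrow> nat \<Rightarrow> nat \<Rightarrow> 'b \<Rightarrow> 'b" where
  "comp_from c j 0 = id"
| "comp_from c j (Suc n) = comp_from c j n \<circ> c (j + n)"

lemma comp_from_add: "comp_from c j (n + m) = comp_from c j n \<circ> comp_from c (j + n) m"
  by (induction m) (simp_all add: comp_assoc add.assoc)

text \<open>The data of the iteration without the collapsing maps: \<open>B k\<close> is the closed
  ball over \<open>p k\<close>. The bound \<open>small\<close> is required for every start
  \<open>j\<close>, so that all tails converge and approach the identity.\<close>

locale blow_up_tower =
  fixes S :: "'b::euclidean_space set" and p :: "nat \<Rightarrow> 'b"
    and c :: "nat \<Rightarrow> 'b \<Rightarrow> 'b" and B :: "nat \<Rightarrow> 'b set"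
  assumes compact_S: "compact S" and p_in_S: "\<And>k. p k \<in> S" and inj_p: "inj p"
    and B_closed: "\<And>k. closed (B k)" and B_subset: "\<And>k. B k \<subseteq> S"
    and B_nonempty: "\<And>k. B k \<noteq> {}"
    and c_cont: "\<And>k. continuous_on S (c k)" and c_in_S: "\<And>k x. x \<in> S \<Longrightarrow> c k x \<in> S"
    and near: "\<And>k. near_homeomorphism S (p ` {..<k}) (comp_from c 0 k)"
    and c_fix: "\<And>k x. x \<in> S \<Longrightarrow>
          comp_from c 0 k x \<in> p ` {..<k} \<or> comp_from c 0 k (c k x) \<in> p ` {..<k} \<Longrightarrow> c k x = x"
    and fibre: "\<And>k x. x \<in> S \<Longrightarrow> comp_from c 0 k (c k x) = p k \<longleftrightarrow> x \<in> B k"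
    and small: "\<And>j n x. x \<in> S \<Longrightarrow>
          dist (comp_from c j (Suc n) x) (comp_from c j n x) \<le> (1/2) ^ (j + n)"
begin

text \<open>The infinite tail starting with \<open>c j\<close>. On \<open>S\<close> the limit is
  unique, so the choice affects only values outside \<open>S\<close>.\<close>

definition lim_from :: "nat \<Rightarrow> 'b \<Rightarrow> 'b" where
  "lim_from j = (SOME l. uniform_limit S (comp_from c j) l sequentially \<and>
     (\<forall>n. \<forall>x\<in>S. dist (l x) (comp_from c j n x) \<le> 2 * (1/2) ^ (j + n)))"

lemma lim_from:
  shows uniform_limit_lim_from: "uniform_limit S (comp_from c j) (lim_from j) sequentially"
    and dist_lim_from: "x \<in> S \<Longrightarrow> dist (lim_from j x) (comp_from c j n x) \<le> 2 * (1/2) ^ (j + n)"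
proof -
  obtain l where "uniform_limit S (comp_from c j) l sequentially"
    "\<And>n x. x \<in> S \<Longrightarrow> dist (l x) (comp_from c j n x) \<le> 2 * (1/2) ^ j * (1/2) ^ n"
    using uniform_limit_geometric[of S "comp_from c j" "(1/2) ^ j"] small
    by (metis power_add)
  then have "\<exists>l. uniform_limit S (comp_from c j) l sequentially \<and>
     (\<forall>n. \<forall>x\<in>S. dist (l x) (comp_from c j n x) \<le> 2 * (1/2) ^ (j + n))"
    by (auto simp: power_add mult.assoc)
  from someI_ex[OF this, folded lim_from_def]
  show "uniform_limit S (comp_from c j) (lim_from j) sequentially"
    and "x \<in> S \<Longrightarrow> dist (lim_from j x) (comp_from c j n x) \<le> 2 * (1/2) ^ (j + n)"
    by auto
qed

lemma comp_from_in_S: "x \<in> S \<Longrightarrow> comp_from c j n x \<in> S"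
  by (induction n arbitrary: x) (simp_all add: c_in_S)

lemma continuous_comp_from: "continuous_on S (comp_from c j n)"
proof (induction n)
  case (Suc n)
  have "continuous_on (c (j + n) ` S) (comp_from c j n)"
    using c_in_S by (intro continuous_on_subset[OF Suc]) blast
  then show ?case
    using continuous_on_compose[OF c_cont] by simp
qed (simp add: id_def)

lemma continuous_lim_from: "continuous_on S (lim_from j)"
  by (rule uniform_limit_theorem[OF _ uniform_limit_lim_from]) (simp_all add: continuous_comp_from)

lemma lim_from_tendsto: "x \<in> S \<Longrightarrow> (\<lambda>n. comp_from c j n x) \<longlonglongrightarrow> lim_from j x"
  by (rule tendsto_uniform_limitI[OF uniform_limit_lim_from])

lemma lim_from_in_S: "x \<in> S \<Longrightarrow> lim_from j x \<in> S"
  using closed_sequentially[OF compact_imp_closed[OF compact_S] _ lim_from_tendsto]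
  by (simp add: comp_from_in_S)

lemma comp_from_lim_from:
  assumes x: "x \<in> S"
  shows "comp_from c j n (lim_from (j + n) x) = lim_from j x"
proof -
  have "(\<lambda>m. comp_from c j n (comp_from c (j + n) m x)) \<longlonglongrightarrow> comp_from c j n (lim_from (j + n) x)"
    using continuous_on_tendsto_compose[OF continuous_comp_from lim_from_tendsto[OF x] lim_from_in_S[OF x]]
    by (simp add: comp_from_in_S x)
  moreover have "(\<lambda>m. comp_from c j (m + n) x) \<longlonglongrightarrow> lim_from j x"
    using lim_from_tendsto[OF x] by (rule LIMSEQ_ignore_initial_segment)
  then have "(\<lambda>m. comp_from c j n (comp_from c (j + n) m x)) \<longlonglongrightarrow> lim_from j x"
    by (simp add: comp_from_add add.commute[of _ n])
  ultimately show ?thesis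
    by (rule LIMSEQ_unique)
qed

lemma lim_from_tendsto_self:
  assumes x: "x \<in> S"
  shows "(\<lambda>j. lim_from j x) \<longlonglongrightarrow> x"
proof (rule tendsto_geometric_bound)
  show "dist (lim_from j x) x \<le> 2 * (1/2) ^ j" for j
    using dist_lim_from[OF x, of j 0] by simp
qed

text \<open>The factor with index \<open>k\<close> sends the ball over \<open>p k\<close>; by
  \<open>c_fix\<close> all later factors leave its points in place.\<close>

lemma comp_from_on_B:
  assumes "x \<in> B k"
  shows "k < m \<Longrightarrow> comp_from c 0 m x = p k"
proof (induction m)
  case (Suc m)
  have x: "x \<in> S"
    using assms B_subset by blast
  show ?case
  proof (cases "m = k")
    case True
    then show ?thesis
      using fibre[OF x] assms by simp
  next
    case False
    then have "comp_from c 0 m x = p k" "k < m"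
      using Suc by auto
    then show ?thesis
      using c_fix[OF x, of m] by auto
  qed
qed simp

text \<open>Factors later than \<open>k\<close> neither move points of \<open>B k\<close> nor bring
  points into it; the two cases use the two alternatives in \<open>c_fix\<close>.\<close>

lemma comp_from_in_B:
  assumes "x \<in> S" "k < j" "x \<in> B k \<or> comp_from c j n x \<in> B k"
  shows "comp_from c j n x = x \<and> x \<in> B k"
  using assms(1,3)
proof (induction n arbitrary: x)
  case 0
  then show ?case by simp
next
  case (Suc n)
  let ?y = "c (j + n) x"
  have y: "?y \<in> S"
    using c_in_S Suc.prems(1) by blast
  have pk: "p k \<in> p ` {..<j + n}"
    using assms(2) by simp
  have eq: "?y = x"
    using Suc.prems(2)
  proof
    assume "x \<in> B k"
    then have "comp_from c 0 (j + n) x = p k"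
      using comp_from_on_B assms(2) by simp
    then show ?thesis
      using c_fix[OF Suc.prems(1), of "j + n"] pk by simp
  next
    assume "comp_from c j (Suc n) x \<in> B k"
    then have "?y \<in> B k"
      using Suc.IH[OF y] by simp
    then have "comp_from c 0 (j + n) ?y = p k"
      using comp_from_on_B assms(2) by simp
    then show ?thesis
      using c_fix[OF Suc.prems(1), of "j + n"] pk by simp
  qed
  show ?case
    using Suc.IH[OF Suc.prems(1)] Suc.prems(2) eq by simp
qed

lemma lim_from_on_B:
  assumes "x \<in> B k" "k < j"
  shows "lim_from j x = x"
proof -
  have x: "x \<in> S"
    using assms(1) B_subset by blast
  then have "comp_from c j n x = x" for n
    using comp_from_in_B assms by blast
  then show ?thesis
    using lim_from_tendsto[OF x, of j] by (simp add: LIMSEQ_const_iff)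
qed

text \<open>A limit could enter a closed set that no approximation meets, so the finite statement is
  applied to later tails: they all put \<open>x\<close> into \<open>B k\<close>, and they converge
  to \<open>x\<close>.\<close>

lemma lim_from_in_B:
  assumes x: "x \<in> S" and "k < j" "lim_from j x \<in> B k"
  shows "x \<in> B k"
proof -
  have "lim_from (n + j) x \<in> B k" for n
    using comp_from_in_B[OF lim_from_in_S[OF x, of "j + n"], of k j n] comp_from_lim_from[OF x, of j n] assms
    by (simp add: add.commute)
  moreover have "(\<lambda>n. lim_from (n + j) x) \<longlonglongrightarrow> x"
    using lim_from_tendsto_self[OF x] by (rule LIMSEQ_ignore_initial_segment)
  ultimately show ?thesis
    by (rule closed_sequentially[OF B_closed])
qed

text \<open>Split the composition after the factor \<open>i\<close>: \<open>fibre\<close> puts the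
  value of the inner part in \<open>B i\<close>, and the inner part brings no new points
  there.\<close>

lemma comp_from_eq_point:
  assumes x: "x \<in> S" and "i < k" and eq: "comp_from c 0 k x = p i"
  shows "x \<in> B i"
proof -
  obtain n where n: "k = Suc i + n"
    using \<open>i < k\<close> less_iff_Suc_add by auto
  let ?y = "comp_from c (Suc i) n x"
  have "comp_from c 0 i (c i ?y) = p i"
    using eq comp_from_add[of c 0 "Suc i" n, THEN fun_cong, of x] n by simp
  then have "?y \<in> B i"
    using fibre comp_from_in_S[OF x] by blast
  then show ?thesis
    using comp_from_in_B[OF x, of i "Suc i" n] by simp
qed

lemma comp_from_eq_imp:
  assumes "x \<in> S" "y \<in> S" "comp_from c 0 k x = comp_from c 0 k y" "x \<noteq> y"
  obtains i where "i < k" "x \<in> B i" "y \<in> B i"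
proof (cases "comp_from c 0 k x \<in> p ` {..<k}")
  case True
  then show ?thesis
    using that comp_from_eq_point assms by (metis imageE lessThan_iff)
next
  case False
  then show ?thesis
    using near_homeomorphism_ex1[OF near, of "comp_from c 0 k x" k] comp_from_in_S assms by (metis DiffI)
qed

abbreviation "limit_map \<equiv> lim_from 0"

lemma comp_lim_from: "x \<in> S \<Longrightarrow> comp_from c 0 k (lim_from k x) = limit_map x"
  using comp_from_lim_from[of x 0 k] by simp

text \<open>The tails tend to the identity, so one of them separates \<open>x\<close> from
  \<open>y\<close>; the finite composition outside it then identifies two points, which happens only
  inside a ball.\<close>

lemma limit_map_eq_imp:
  assumes x: "x \<in> S" and y: "y \<in> S" and eq: "limit_map x = limit_map y" and "x \<noteq> y"
  obtains i where "x \<in> B i" "y \<in> B i"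
proof -
  have "\<exists>k. lim_from k x \<noteq> lim_from k y"
  proof (rule ccontr)
    assume "\<nexists>k. lim_from k x \<noteq> lim_from k y"
    then have "(\<lambda>k. lim_from k x) = (\<lambda>k. lim_from k y)"
      by blast
    then show False
      using LIMSEQ_unique lim_from_tendsto_self[OF x] lim_from_tendsto_self[OF y] \<open>x \<noteq> y\<close> by metis
  qed
  then obtain k where "lim_from k x \<noteq> lim_from k y" ..
  moreover have "comp_from c 0 k (lim_from k x) = comp_from c 0 k (lim_from k y)"
    using comp_lim_from x y eq by simp
  ultimately obtain i where "i < k" "lim_from k x \<in> B i" "lim_from k y \<in> B i"
    using comp_from_eq_imp lim_from_in_S x y by metis
  then show ?thesis
    using that lim_from_in_B x y by blast
qed

lemma limit_map_eq_point_iff: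
  assumes x: "x \<in> S"
  shows "limit_map x = p k \<longleftrightarrow> x \<in> B k"
proof
  assume "limit_map x = p k"
  then have "lim_from (Suc k) x \<in> B k"
    using comp_lim_from[OF x, of "Suc k"] comp_from_eq_point[OF lim_from_in_S[OF x], of k "Suc k" "Suc k"]
    by simp
  then show "x \<in> B k"
    using lim_from_in_B[OF x] by blast
next
  assume "x \<in> B k"
  then show "limit_map x = p k"
    using comp_lim_from[OF x, of "Suc k"] lim_from_on_B[of x k "Suc k"] comp_from_on_B[of x k "Suc k"]
    by simp
qed

lemma B_disjoint:
  assumes "i \<noteq> j"
  shows "B i \<inter> B j = {}"
proof (rule ccontr)
  assume "B i \<inter> B j \<noteq> {}"
  then obtain x where x: "x \<in> B i" "x \<in> B j"
    by blast
  then have "x \<in> S"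
    using B_subset by blast
  then have "p i = p j"
    using limit_map_eq_point_iff x by metis
  then show False
    using inj_p assms by (simp add: inj_eq)
qed

text \<open>Each finite composition is onto and uniformly close to the limit, so the image is dense
  in \<open>S\<close>; it is also compact.\<close>

lemma limit_map_image: "limit_map ` S = S"
proof
  show "limit_map ` S \<subseteq> S"
    using lim_from_in_S by blast
  have "compact (limit_map ` S)"
    by (intro compact_continuous_image continuous_lim_from compact_S)
  then have cl: "closed (limit_map ` S)"
    by (rule compact_imp_closed)
  show "S \<subseteq> limit_map ` S"
  proof
    fix y assume y: "y \<in> S"
    have "\<exists>x\<in>S. comp_from c 0 k x = y" for k
    proof (cases "y \<in> p ` {..<k}")
      case True
      then obtain i where "y = p i" "i < k"
        by auto
      moreover obtain x where "x \<in> B i"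
        using B_nonempty by blast
      ultimately show ?thesis
        using comp_from_on_B B_subset by blast
    next
      case False
      then show ?thesis
        using near_homeomorphism_ex1[OF near, of y k] y by blast
    qed
    then obtain x where x: "\<And>k. x k \<in> S" "\<And>k. comp_from c 0 k (x k) = y"
      by metis
    have "(\<lambda>k. limit_map (x k)) \<longlonglongrightarrow> y"
    proof (rule tendsto_geometric_bound)
      show "dist (limit_map (x k)) y \<le> 2 * (1/2) ^ k" for k
        using dist_lim_from[OF x(1), of 0 k k] x(2)[of k] by simp
    qed
    then show "y \<in> limit_map ` S"
      by (rule closed_sequentially[OF cl, rotated]) (use x(1) in blast)
  qed
qed

text \<open>A point outside the closure \<open>?K\<close> is the only one in its fibre, so its image
  lies outside the compact image of \<open>?K\<close>. By density some \<open>p k\<close> does too,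
  although \<open>B k\<close> lies over it.\<close>

lemma closure_Union_B:
  assumes dense: "S \<subseteq> closure (range p)"
  shows "closure (\<Union>k. B k) = S"
proof
  let ?K = "closure (\<Union>k. B k)"
  show KS: "?K \<subseteq> S"
    using B_subset compact_imp_closed[OF compact_S] by (intro closure_minimal) auto
  show "S \<subseteq> ?K"
  proof
    fix x assume x: "x \<in> S"
    show "x \<in> ?K"
    proof (rule ccontr)
      assume "x \<notin> ?K"
      then have *: "limit_map x \<notin> limit_map ` ?K"
        using limit_map_eq_imp[OF x] KS closure_subset[of "\<Union>k. B k"] by (smt (verit) UN_I UNIV_I imageE subsetD)
      have "compact ?K"
        using bounded_subset[OF compact_imp_bounded[OF compact_S] KS]
        by (simp only: compact_eq_bounded_closed closed_closure simp_thms)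
      then have "closed (limit_map ` ?K)"
        by (intro compact_imp_closed compact_continuous_image continuous_on_subset[OF continuous_lim_from KS])
      moreover have "limit_map x \<in> closure (range p)"
        using dense lim_from_in_S[OF x] by blast
      ultimately have "range p \<inter> - limit_map ` ?K \<noteq> {}"
        using * open_Int_closure_eq_empty[of "- limit_map ` ?K" "range p"] open_Compl by blast
      then obtain k where k: "p k \<notin> limit_map ` ?K"
        by auto
      obtain y where y: "y \<in> B k"
        using B_nonempty by blast
      then have "y \<in> ?K"
        by (intro subsetD[OF closure_subset]) blast
      moreover have "limit_map y = p k"
        using y limit_map_eq_point_iff[of y k] B_subset[of k] by (simp add: subset_iff)
      ultimately show False
        using k by (metis imageI)
    qed
  qed
qed

end

subsection \<open>The carpet\<close>

lemma finite_uniform_modulus: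
  fixes T :: "('b::metric_space \<Rightarrow> 'c::metric_space) set"
  assumes "finite T" "\<And>f. f \<in> T \<Longrightarrow> uniformly_continuous_on S f" "0 < \<epsilon>"
  obtains d where "0 < d" "\<And>f x y. f \<in> T \<Longrightarrow> x \<in> S \<Longrightarrow> y \<in> S \<Longrightarrow> dist y x < d \<Longrightarrow> dist (f y) (f x) < \<epsilon>"
proof -
  have "\<forall>f. \<exists>d>0. f \<in> T \<longrightarrow> (\<forall>x\<in>S. \<forall>y\<in>S. dist y x < d \<longrightarrow> dist (f y) (f x) < \<epsilon>)"
    using assms(2,3) unfolding uniformly_continuous_on_def by (metis zero_less_one)
  then obtain \<delta> where \<delta>: "\<And>f. 0 < \<delta> f"
    "\<And>f x y. f \<in> T \<Longrightarrow> x \<in> S \<Longrightarrow> y \<in> S \<Longrightarrow> dist y x < \<delta> f \<Longrightarrow> dist (f y) (f x) < \<epsilon>"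
    by metis
  show ?thesis
  \<comment> \<open>Inserting 1 keeps the minimum meaningful for empty \<open>T\<close>.\<close>
  proof (rule that[of "Min (insert 1 (\<delta> ` T))"])
    show "0 < Min (insert 1 (\<delta> ` T))"
      using assms(1) \<delta>(1) by simp
    show "dist (f y) (f x) < \<epsilon>"
      if "f \<in> T" "x \<in> S" "y \<in> S" "dist y x < Min (insert 1 (\<delta> ` T))" for f x y
      using that assms(1) by (intro \<delta>(2)) auto
  qed
qed

text \<open>Dependent choice: each factor is made small against the moduli of continuity of all
  finitely many compositions that it will extend.\<close>

lemma blow_up_sequence:
  fixes p :: "nat \<Rightarrow> 'a::euclidean_space \<times> real" and \<pi> :: "nat \<Rightarrow> 'a \<Rightarrow> 'a \<times> real"
  assumes p: "\<And>k. p k \<in> sphere 0 1" "inj p" and coll: "\<And>k. collapsing_map (p k) (\<pi> k)"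
  obtains c C a where
    "\<And>k. blow_up (p k) (\<pi> k) (p ` {..<k}) (comp_from c 0 k) (c k) (C k) (a k)"
    "\<And>j n x. x \<in> sphere 0 1 \<Longrightarrow>
       dist (comp_from c j (Suc n) x) (comp_from c j n x) \<le> (1/2) ^ (j + n)"
    "\<And>k. diameter (closure (C k)) \<le> (1/2) ^ k"
proof -
  let ?S = "sphere 0 1 :: ('a \<times> real) set"
  \<comment> \<open>The state holds the full composition and the set of all
    \<open>comp_from c j m\<close> with \<open>j + m = n\<close>. The clause for
    \<open>n = 0\<close> pins down the start, and \<open>id\<close> opens the next tail.\<close>
  define I where "I n st \<longleftrightarrow> (n = 0 \<longrightarrow> st = (id, {id})) \<and>
      near_homeomorphism ?S (p ` {..<n}) (fst st) \<and> finite (snd st) \<and> id \<in> snd st \<and>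
      (\<forall>f\<in>snd st. continuous_on ?S f)" for n and st :: "('a \<times> real \<Rightarrow> 'a \<times> real) \<times> _"
  define Q where "Q n st st' c C a \<longleftrightarrow>
      blow_up (p n) (\<pi> n) (p ` {..<n}) (fst st) c C a \<and>
      (\<forall>f\<in>snd st. \<forall>x\<in>?S. dist (f (c x)) (f x) \<le> (1/2) ^ n) \<and>
      diameter (closure C) \<le> (1/2) ^ n \<and>
      st' = (fst st \<circ> c, insert id ((\<lambda>f. f \<circ> c) ` snd st))"
    for n st st' and c :: "'a \<times> real \<Rightarrow> 'a \<times> real" and C and a :: "'a \<times> real \<Rightarrow> 'a"
  have base: "\<exists>st. I 0 st"
    unfolding I_def using near_homeomorphism_id[of ?S]
    by (intro exI[of _ "(id, {id})"]) (simp add: continuous_on_id')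
  have step: "\<exists>st'. I (Suc n) st' \<and> (\<exists>c C a. Q n st st' c C a)" if I: "I n st" for n st
  proof -
    have T: "finite (snd st)" "\<And>f. f \<in> snd st \<Longrightarrow> continuous_on ?S f"
      and near: "near_homeomorphism ?S (p ` {..<n}) (fst st)"
      using I unfolding I_def by auto
    have "uniformly_continuous_on ?S f" if "f \<in> snd st" for f
      using T(2)[OF that] by (intro compact_uniformly_continuous) auto
    then obtain d where d: "0 < d"
      "\<And>f x y. f \<in> snd st \<Longrightarrow> x \<in> ?S \<Longrightarrow> y \<in> ?S \<Longrightarrow> dist y x < d \<Longrightarrow> dist (f y) (f x) < (1/2) ^ n"
      using finite_uniform_modulus[OF T(1), of ?S "(1/2) ^ n"] by (metis half_gt_zero_iff zero_less_one zero_less_power)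
    \<comment> \<open>\<open>d\<close> controls the compositions, \<open>(1/2) ^ n\<close> the
      diameter of the hole.\<close>
    define \<eta> where "\<eta> = min d ((1/2) ^ n)"
    have \<eta>: "0 < \<eta>" "\<eta> \<le> d" "\<eta> \<le> (1/2) ^ n"
      using d(1) by (simp_all add: \<eta>_def)
    have F: "finite (p ` {..<n})" "p ` {..<n} \<subseteq> ?S"
      using p(1) by blast+
    have pn: "p n \<in> ?S - p ` {..<n}"
      using p by (metis Diff_iff imageE injD lessThan_iff less_irrefl)
    obtain c C a where bu: "blow_up (p n) (\<pi> n) (p ` {..<n}) (fst st) c C a"
      and c_small: "\<And>x. x \<in> ?S \<Longrightarrow> dist (c x) x < \<eta>" and C_small: "diameter (closure C) \<le> \<eta>"
      using blow_up_step[OF near F coll pn \<eta>(1)] by blast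
    then have near': "near_homeomorphism ?S (insert (p n) (p ` {..<n})) (fst st \<circ> c)"
      and c: "continuous_on ?S c" "c ` ?S \<subseteq> ?S"
      unfolding blow_up_def by blast+
    note bu
    moreover have "dist (f (c x)) (f x) \<le> (1/2) ^ n" if f: "f \<in> snd st" and x: "x \<in> ?S" for f x
    proof -
      have "c x \<in> ?S" "dist (c x) x < d"
        using c(2) c_small[OF x] x \<eta>(2) by (blast, linarith)
      then show ?thesis
        using d(2)[OF f x] by (simp add: less_imp_le)
    qed
    moreover have "diameter (closure C) \<le> (1/2) ^ n"
      using C_small \<eta>(3) by linarith
    ultimately have "Q n st (fst st \<circ> c, insert id ((\<lambda>f. f \<circ> c) ` snd st)) c C a"
      unfolding Q_def by blast
    moreover have "I (Suc n) (fst st \<circ> c, insert id ((\<lambda>f. f \<circ> c) ` snd st))"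
    proof -
      have "continuous_on ?S (f \<circ> c)" if "f \<in> snd st" for f
        using c(1) continuous_on_subset[OF T(2)[OF that] c(2)] by (rule continuous_on_compose)
      moreover have "continuous_on ?S id"
        by (simp add: id_def)
      moreover have "p ` {..<Suc n} = insert (p n) (p ` {..<n})"
        by (simp add: lessThan_Suc)
      ultimately show ?thesis
        using near' T(1) unfolding I_def by auto
    qed
    ultimately show ?thesis
      by blast
  qed
  obtain st where st: "\<And>n. I n (st n)" "\<And>n. \<exists>c C a. Q n (st n) (st (Suc n)) c C a"
    using dependent_nat_choice[of I "\<lambda>n st st'. \<exists>c C a. Q n st st' c C a", OF base step] by blast
  then obtain c C a where Q: "\<And>n. Q n (st n) (st (Suc n)) (c n) (C n) (a n)"
    by metis
  have fst_st: "fst (st n) = comp_from c 0 n" for n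
  proof (induction n)
    case 0
    then show ?case using st(1)[of 0] by (simp add: I_def)
  next
    case (Suc n)
    then show ?case using Q[of n] by (simp add: Q_def)
  qed
  have snd_st: "comp_from c j n \<in> snd (st (j + n))" for j n
  proof (induction n)
    case 0
    have "id \<in> snd (st j)"
      using st(1)[of j] unfolding I_def by blast
    then show ?case by (simp only: comp_from.simps add_0_right)
  next
    case (Suc n)
    have "st (Suc (j + n)) = (fst (st (j + n)) \<circ> c (j + n), insert id ((\<lambda>f. f \<circ> c (j + n)) ` snd (st (j + n))))"
      using Q[of "j + n"] unfolding Q_def by blast
    then show ?case
      using Suc by (simp only: comp_from.simps add_Suc_right snd_conv insert_iff) blast
  qed
  show ?thesis
  proof (rule that)
    show "blow_up (p k) (\<pi> k) (p ` {..<k}) (comp_from c 0 k) (c k) (C k) (a k)" for k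
      using Q[of k] fst_st[of k] unfolding Q_def by simp
    show "dist (comp_from c j (Suc n) x) (comp_from c j n x) \<le> (1/2) ^ (j + n)"
      if "x \<in> ?S" for j n x
      using Q[of "j + n"] snd_st[of j n] that unfolding Q_def by simp
    show "diameter (closure (C k)) \<le> (1/2) ^ k" for k
      using Q[of k] unfolding Q_def by simp
  qed
qed

lemma blow_up_tower_sphere:
  fixes p :: "nat \<Rightarrow> 'a::euclidean_space \<times> real"
  assumes p: "\<And>k. p k \<in> sphere 0 1" "inj p"
    and bu: "\<And>k. blow_up (p k) (\<pi> k) (p ` {..<k}) (comp_from c 0 k) (c k) (C k) (a k)"
    and small: "\<And>j n x. x \<in> sphere 0 1 \<Longrightarrow>
       dist (comp_from c j (Suc n) x) (comp_from c j n x) \<le> (1/2) ^ (j + n)"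
  shows "blow_up_tower (sphere 0 1) p c (\<lambda>k. closure (C k))"
proof
  let ?S = "sphere 0 1 :: ('a \<times> real) set"
  note b = bu[unfolded blow_up_def]
  show "compact ?S" by simp
  show "p k \<in> ?S" for k by (rule p)
  show "inj p" by (rule p)
  show "closed (closure (C k))" for k by simp
  have "C k \<subseteq> ?S" for k
    using b[of k] openin_subset by fastforce
  then show "closure (C k) \<subseteq> ?S" for k
    by (simp add: closure_minimal)
  show "closure (C k) \<noteq> {}" for k
    using b[of k] unfolding tame_ball_def by (metis homeomorphic_empty(2) cball_eq_empty not_one_less_zero)
  show "continuous_on ?S (c k)" for k
    using b[of k] by blast
  show "c k x \<in> ?S" if "x \<in> ?S" for k x
    using b[of k] that by blast
  show "near_homeomorphism ?S (p ` {..<k}) (comp_from c 0 k)" for k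
  proof (cases k)
    case 0
    then show ?thesis by (simp add: near_homeomorphism_id)
  next
    case (Suc m)
    then show ?thesis
      using b[of m] by (simp add: lessThan_Suc)
  qed
  show "c k x = x" if "x \<in> ?S" "comp_from c 0 k x \<in> p ` {..<k} \<or> comp_from c 0 k (c k x) \<in> p ` {..<k}" for k x
    using b[of k] that by blast
  show "comp_from c 0 k (c k x) = p k \<longleftrightarrow> x \<in> closure (C k)" if "x \<in> ?S" for k x
    using b[of k] that by blast
qed (rule small)

theorem theorem2p8:
  fixes P :: "('a::euclidean_space \<times> real) set"
    and \<pi> :: "'a \<times> real \<Rightarrow> 'a \<Rightarrow> 'a \<times> real"
  assumes "countable P"
    and "P \<subseteq> sphere 0 1"
    and "sphere 0 1 \<subseteq> closure P"
    and "\<And>p. p \<in> P \<Longrightarrow> collapsing_map p (\<pi> p)"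
  shows "\<exists>M :: ('a \<times> real) set.
           sierpinski_carpet M \<and> limit_space P \<pi> homeomorphic_space top_of_set M"
proof -
  let ?S = "sphere 0 1 :: ('a \<times> real) set"
  \<comment> \<open>A bijective enumeration by the naturals is wanted. A finite dense set would be
    closed, making the sphere finite, whereas it is connected and contains
    \<open>v \<noteq> - v\<close>.\<close>
  have "infinite P"
  proof
    assume "finite P"
    then have "finite ?S"
      using assms(3) by (metis closure_closed finite_imp_closed finite_subset)
    moreover obtain v :: "'a \<times> real" where "v \<in> Basis"
      using nonempty_Basis by blast
    then have "v \<in> ?S" "- v \<in> ?S" "v \<noteq> - v"
      by (auto simp: eq_neg_iff_add_eq_0 simp flip: scaleR_2)
    moreover have "connected ?S"
      using DIM_positive[where 'a='a] by (intro connected_sphere) (simp add: Suc_leI)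
    ultimately show False
      by (metis connected_finite_iff_sing empty_iff singletonD)
  qed
  then obtain p :: "nat \<Rightarrow> 'a \<times> real" where p: "bij_betw p UNIV P"
    using bij_betw_from_nat_into[OF assms(1)] by blast
  have p_range: "range p = P" and p_inj: "inj p"
    using p by (auto simp: bij_betw_def)
  have p_S: "p k \<in> ?S" for k
    using p_range assms(2) by blast
  have coll: "collapsing_map (p k) (\<pi> (p k))" for k
    using p_range assms(4) by blast
  obtain c C a where
    bu: "\<And>k. blow_up (p k) (\<pi> (p k)) (p ` {..<k}) (comp_from c 0 k) (c k) (C k) (a k)"
    and small: "\<And>j n x. x \<in> ?S \<Longrightarrow>
       dist (comp_from c j (Suc n) x) (comp_from c j n x) \<le> (1/2) ^ (j + n)"
    and diam: "\<And>k. diameter (closure (C k)) \<le> (1/2) ^ k"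
    using blow_up_sequence[OF p_S p_inj coll] by blast
  interpret blow_up_tower ?S p c "\<lambda>k. closure (C k)"
    using blow_up_tower_sphere[OF p_S p_inj bu small] .
  have C: "openin (top_of_set ?S) (C k)" "tame_ball (C k)"
    and a_cont: "continuous_on (?S - C k) (a k)"
    and a_lift: "\<And>x. x \<in> ?S - C k \<Longrightarrow> norm (a k x) \<le> 1 \<and> \<pi> (p k) (a k x) = comp_from c 0 k (c k x)"
    and a_bij: "bij_betw (a k) (closure (C k) - C k) (sphere 0 1)" for k
    using bu[of k] unfolding blow_up_def by blast+

  \<comment> \<open>The carpet left by the holes\<close>
  define M where "M = ?S - (\<Union>k. C k)"
  have carpet: "sierpinski_carpet M"
    unfolding sierpinski_carpet_def
  proof (intro exI[of _ C] conjI)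
    show "carpet_family C"
      unfolding carpet_family_def
    proof (intro conjI allI impI C)
      show "closure (C i) \<inter> closure (C j) = {}" if "i \<noteq> j" for i j
        using B_disjoint[OF that] .
      show "closure (\<Union>i. closure (C i)) = ?S"
        using closure_Union_B assms(3) by (simp add: p_range)
      show "finite {i. diameter (closure (C i)) > \<epsilon>}" if "0 < \<epsilon>" for \<epsilon>
      proof -
        obtain n where n: "(1/2) ^ n < \<epsilon>"
          using real_arch_pow_inv[OF \<open>0 < \<epsilon>\<close>, of "1/2"] by auto
        have "i < n" if "diameter (closure (C i)) > \<epsilon>" for i
        proof (rule ccontr)
          assume "\<not> i < n"
          then have "(1/2) ^ i \<le> (1/2 :: real) ^ n"
            by (intro power_decreasing) auto
          then show False
            using that diam[of i] n by linarith
        qed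
        then have "{i. diameter (closure (C i)) > \<epsilon>} \<subseteq> {..<n}"
          by blast
        then show ?thesis
          by (rule finite_subset) simp
      qed
    qed
  qed (rule M_def)
  have MS: "M \<subseteq> ?S"
    by (auto simp: M_def)
  have M_compact: "compact M"
  proof -
    have "openin (top_of_set ?S) (\<Union>k. C k)"
      using C(1) by blast
    then have "closedin (top_of_set ?S) M"
      unfolding M_def by (metis closedin_diff closedin_topspace topspace_euclidean_subtopology)
    then show ?thesis
      using closedin_compact[OF compact_S] by blast
  qed
  have M_notin: "x \<notin> C k" if "x \<in> M" for x k
    using that by (auto simp: M_def)

  \<comment> \<open>Lifts of the limit map\<close>
  define e where "e k = a k \<circ> lim_from (Suc k)" for k
  have lim_M: "lim_from (Suc k) x \<in> ?S - C k" if x: "x \<in> M" for k x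
  proof -
    have "lim_from (Suc k) x \<notin> C k"
    proof
      assume *: "lim_from (Suc k) x \<in> C k"
      then have "x \<in> closure (C k)"
        using lim_from_in_B[of x k "Suc k"] x MS closure_subset by blast
      then have "lim_from (Suc k) x = x"
        using lim_from_on_B by blast
      then show False
        using * M_notin[OF x] by simp
    qed
    then show ?thesis
      using lim_from_in_S x MS by blast
  qed
  have e_cont: "continuous_on M (e k)" for k
  proof -
    have "continuous_on (lim_from (Suc k) ` M) (a k)"
      by (rule continuous_on_subset[OF a_cont]) (use lim_M in blast)
    then show ?thesis
      unfolding e_def by (rule continuous_on_compose[OF continuous_on_subset[OF continuous_lim_from MS]])
  qed
  \<comment> \<open>The limit map is
    \<open>comp_from c 0 k \<circ> c k \<circ> lim_from (Suc k)\<close>, and \<open>a k\<close>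
    lifts the first two factors through \<open>\<pi> (p k)\<close>.\<close>
  have e_norm: "norm (e k x) \<le> 1" and e_lift: "\<pi> (p k) (e k x) = limit_map x" if x: "x \<in> M" for k x
  proof -
    have "comp_from c 0 k (c k (lim_from (Suc k) x)) = limit_map x"
      using comp_lim_from[of x "Suc k"] x MS by auto
    then show "norm (e k x) \<le> 1" "\<pi> (p k) (e k x) = limit_map x"
      using a_lift[OF lim_M[OF x, of k]] unfolding e_def comp_apply by auto
  qed
  have e_B: "e k x = a k x" if "x \<in> closure (C k)" for k x
    using lim_from_on_B[OF that] by (simp add: e_def)
  have e_inj: "x = y" if x: "x \<in> M" and y: "y \<in> M" and eq: "\<And>k. e k x = e k y" for x y
  proof (rule ccontr)
    assume "x \<noteq> y"
    have "limit_map x = limit_map y"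
      using e_lift[OF x, of 0] e_lift[OF y, of 0] eq by simp
    then obtain i where i: "x \<in> closure (C i)" "y \<in> closure (C i)"
      using limit_map_eq_imp \<open>x \<noteq> y\<close> x y MS by blast
    \<comment> \<open>On the ball over \<open>p i\<close> the tail is the identity, so
      \<open>e i\<close> is \<open>a i\<close>, which is injective on the boundary of the
      hole.\<close>
    then have "a i x = a i y"
      using e_B eq by metis
    then show False
      using inj_onD[OF bij_betw_imp_inj_on[OF a_bij[of i]]] i M_notin x y \<open>x \<noteq> y\<close> by blast
  qed
  have e_surj: "\<exists>x\<in>M. \<forall>k. e k x = y k"
    if y: "\<And>k. norm (y k) \<le> 1" and eq: "\<And>k l. \<pi> (p k) (y k) = \<pi> (p l) (y l)" for y
  proof -
    define s where "s = \<pi> (p 0) (y 0)"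
    have s: "\<pi> (p k) (y k) = s" for k
      unfolding s_def by (rule eq)
    \<comment> \<open>Coordinates with \<open>p k \<noteq> s\<close> are determined by
      \<open>s\<close>, because \<open>\<pi> (p k)\<close> is injective away from the boundary. Only
      a coordinate with \<open>p k = s\<close> has to be matched by hand.\<close>
    have other: "e k x = y k" if x: "x \<in> M" "limit_map x = s" and "s \<noteq> p k" for x k
    proof -
      have "\<pi> (p k) (e k x) = \<pi> (p k) (y k)"
        using e_lift[OF x(1)] x(2) s by simp
      then have "e k x = y k \<or> norm (y k) = 1"
        using collapsing_map_eq_iff[OF coll e_norm[OF x(1)] y] by blast
      then show ?thesis
        using collapsing_map_eq_point_iff[OF coll y] s \<open>s \<noteq> p k\<close> by metis
    qed
    show ?thesis
    proof (cases "s \<in> range p")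
      case False
      have "s \<in> ?S"
        using collapsing_map_in_sphere[OF coll[of 0] y[of 0]] by (simp only: s_def)
      then have "s \<in> limit_map ` ?S"
        by (simp only: limit_map_image)
      then obtain x where x: "x \<in> ?S" "limit_map x = s"
        by (metis imageE)
      have "x \<notin> C k" for k
      proof
        assume "x \<in> C k"
        then have "s = p k"
          using limit_map_eq_point_iff[OF x(1), of k] x(2) closure_subset[of "C k"] by (metis subsetD)
        then show False
          using False by blast
      qed
      then have "x \<in> M"
        using x(1) by (simp add: M_def)
      then show ?thesis
        using other x(2) False by blast
    next
      case True
      then obtain k where k: "s = p k"
        by blast
      then have "norm (y k) = 1"
        using collapsing_map_eq_point_iff[OF coll[of k] y[of k]] s[of k] by metis
      then have "y k \<in> sphere 0 1"
        by simp
      \<comment> \<open>Here \<open>y k\<close> is a unit vector, and the boundary of the hole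
        \<open>C k\<close> supplies exactly one point with this lift.\<close>
      then have "y k \<in> a k ` (closure (C k) - C k)"
        by (simp only: bij_betw_imp_surj_on[OF a_bij])
      then obtain x where "y k = a k x" "x \<in> closure (C k) - C k" ..
      then have x: "x \<in> closure (C k)" "x \<notin> C k" "a k x = y k"
        by simp_all
      have xS: "x \<in> ?S"
        by (rule subsetD[OF B_subset x(1)])
      have "x \<notin> C i" for i
      proof (cases "i = k")
        case False
        then show ?thesis
          using B_disjoint[OF False] x(1) closure_subset[of "C i"] by blast
      qed (use x in simp)
      then have xM: "x \<in> M"
        using xS by (simp add: M_def)
      have "limit_map x = s"
        using limit_map_eq_point_iff[OF xS, of k] x(1) k by (simp only: simp_thms)
      then have "e j x = y j" for j
      proof (cases "j = k")
        case True
        then show ?thesis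
          using e_B[OF x(1)] x(3) by simp
      next
        case False
        then have "s \<noteq> p j"
          using p_inj k by (simp add: inj_eq)
        then show ?thesis
          using other[OF xM \<open>limit_map x = s\<close>] by blast
      qed
      then show ?thesis
        using xM by blast
    qed
  qed

  \<comment> \<open>The homeomorphism onto the limit space\<close>
  define idx where "idx = inv p"
  have idx: "p (idx q) = q" if "q \<in> P" for q
    using that p_range unfolding idx_def by (metis f_inv_into_f)
  have idx_p: "idx (p k) = k" for k
    using p_inj by (simp add: idx_def)
  \<comment> \<open>Restricted to \<open>P\<close>, as points of the product topology are
    extensional functions.\<close>
  define \<Phi> where "\<Phi> x = (\<lambda>q\<in>P. e (idx q) x)" for x
  define Y where "Y = product_topology (\<lambda>q::'a \<times> real. top_of_set (cball (0::'a) 1)) P"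
  define L where "L = {x. \<forall>q\<in>P. \<forall>q'\<in>P. \<pi> q (x q) = \<pi> q' (x q')}"
  have lim_eq: "limit_space P \<pi> = subtopology Y L"
    by (simp add: limit_space_def Y_def L_def)
  have top_Y: "topspace Y = (\<Pi>\<^sub>E q\<in>P. cball 0 1)"
    by (simp add: Y_def)
  have \<Phi>_in: "\<Phi> x \<in> topspace Y \<inter> L" if x: "x \<in> M" for x
  proof
    show "\<Phi> x \<in> topspace Y"
      unfolding top_Y \<Phi>_def using e_norm[OF x] by (simp add: PiE_iff)
    have "\<pi> q (\<Phi> x q) = limit_map x" if "q \<in> P" for q
      using e_lift[OF x, of "idx q"] idx[OF that] that by (simp add: \<Phi>_def)
    then show "\<Phi> x \<in> L"
      unfolding L_def by simp
  qed
  have "homeomorphic_map (top_of_set M) (subtopology Y L) \<Phi>"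
  \<comment> \<open>A continuous bijection from a compact onto a Hausdorff space is a homeomorphism,
    so no continuity of the inverse has to be shown.\<close>
  proof (rule continuous_imp_homeomorphic_map)
    have "continuous_map (top_of_set M) (top_of_set (cball 0 1)) (\<lambda>x. \<Phi> x q)" if "q \<in> P" for q
      using e_cont[of "idx q"] e_norm that by (auto simp: \<Phi>_def continuous_map_in_subtopology)
    moreover have "\<Phi> \<in> topspace (top_of_set M) \<rightarrow> extensional P"
      by (auto simp: \<Phi>_def)
    ultimately have "continuous_map (top_of_set M) Y \<Phi>"
      unfolding Y_def by (simp add: continuous_map_componentwise image_subset_iff_funcset)
    then show "continuous_map (top_of_set M) (subtopology Y L) \<Phi>"
      using \<Phi>_in by (simp add: continuous_map_in_subtopology image_subset_iff)
    show "compact_space (top_of_set M)"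
      using M_compact by (simp add: compact_space_subtopology)
    show "Hausdorff_space (subtopology Y L)"
      unfolding Y_def by (intro Hausdorff_space_subtopology)
        (simp add: Hausdorff_space_product_topology Hausdorff_space_subtopology)
    show "inj_on \<Phi> (topspace (top_of_set M))"
    proof (rule inj_onI)
      fix x y assume xy: "x \<in> topspace (top_of_set M)" "y \<in> topspace (top_of_set M)" and "\<Phi> x = \<Phi> y"
      then have "\<Phi> x (p k) = \<Phi> y (p k)" for k
        by simp
      then have "e k x = e k y" for k
        using p_range idx_p by (auto simp: \<Phi>_def)
      then show "x = y"
        using e_inj xy by simp
    qed
    show "\<Phi> ` topspace (top_of_set M) = topspace (subtopology Y L)"
    proof
      show "\<Phi> ` topspace (top_of_set M) \<subseteq> topspace (subtopology Y L)"
        using \<Phi>_in by auto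
      show "topspace (subtopology Y L) \<subseteq> \<Phi> ` topspace (top_of_set M)"
      proof
        fix z assume "z \<in> topspace (subtopology Y L)"
        then have zY: "z \<in> (\<Pi>\<^sub>E q\<in>P. cball 0 1)" and zL: "z \<in> L"
          using top_Y by simp_all
        have pP: "p k \<in> P" for k
          using p_range by blast
        have "norm (z (p k)) \<le> 1" for k
          using PiE_mem[OF zY pP] by simp
        moreover have "\<pi> (p k) (z (p k)) = \<pi> (p l) (z (p l))" for k l
          using zL pP unfolding L_def by blast
        ultimately obtain x where x: "x \<in> M" "\<And>k. e k x = z (p k)"
          using e_surj[of "\<lambda>k. z (p k)"] by blast
        have "\<Phi> x = z"
        proof
          show "\<Phi> x q = z q" for q
            using x(2)[of "idx q"] idx[of q] PiE_arb[OF zY, of q] by (auto simp: \<Phi>_def)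
        qed
        then show "z \<in> \<Phi> ` topspace (top_of_set M)"
          using x(1) by auto
      qed
    qed
  qed
  then have "limit_space P \<pi> homeomorphic_space top_of_set M"
    unfolding lim_eq using homeomorphic_map_imp_homeomorphic_space homeomorphic_space_sym by blast
  then show ?thesis
    using carpet by blast
qed

end
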